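(* Let $P^*$ be an order-preserving semiflow on $\mathcal P_2(\mathbb{R})$. Assume that there exists an eventually positively invariant, order bounded, closed set $K\subset\mathcal P_2(\mathbb{R})$ such that $K$ attracts each bounded subset of $\mathcal P_2(\mathbb{R})$. Then: (i) $\omega(K)=\bigcap_{t\ge0}P_t^*K$ is the global attractor. Furthermore, if $K$ is connected in $\mathcal P_2(\mathbb{R})$, then $\omega(K)$ is connected in $\mathcal P_2(\mathbb{R})$. (ii) $\omega(K)\subset[\underline\nu,\overline\nu]$, where $\underline\nu,\overline\nu\in\omega(K)$ are invariant measures. (iii) $\underline\nu$ is globally attracting from below and $\overline\nu$ is globally attracting from above, i.e. for any $\rho\le_{\mathrm{st}}\underline\nu$, $\mathcal W_2(P_t^*\rho,\underline\nu)\to0$ as $t\to\infty$; for any $\rho\ge_{\mathrm{st}}\overline\nu$, $\mathcal W_2(P_t^*\rho,\overline\nu)\to0$ as $t\to\infty$. (iv) If $\underline\nu$ attracts a set $U\subset\mathcal P_2(\mathbb{R})$, then $\underline\nu$ attracts each measure in $\bigcup_{\mu\in U}\{\rho\in\mathcal P_2(\mathbb{R}):\rho\le_{\mathrm{st}}\mu\}$. Correspondingly, if $\overline\nu$ attracts a set $V\subset\mathcal P_2(\mathbb{R})$, then $\overline\nu$ attracts each measure in $\bigcup_{\mu\in V}\{\rho\in\mathcal P_2(\mathbb{R}):\rho\ge_{\mathrm{st}}\mu\}$. (v) If there exists $\rho_1<_{\mathrm{st}}\overline\nu$ (resp. $\rho_2>_{\mathrm{st}}\underline\nu$) such that $\mathcal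 W_2(P_t^*\rho_1,\overline\nu)\to0$ (resp. $\mathcal W_2(P_t^*\rho_2,\underline\nu)\to0$) as $t\to\infty$, then for any $\rho\ge_{\mathrm{st}}\rho_1$ (resp. $\rho\le_{\mathrm{st}}\rho_2$) one has $\mathcal W_2(P_t^*\rho,\overline\nu)\to0$ (resp. $\mathcal W_2(P_t^*\rho,\underline\nu)\to0$) as $t\to\infty$. (vi) If $P^*$ has a unique invariant measure $\nu$, then the singleton $\{\nu\}$ is the global attractor; that is, $\nu$ attracts all bounded subsets of $\mathcal P_2(\mathbb{R})$.
   Context: $\mathcal P_2(\mathbb{R})$ is the set of Borel probability measures on $\mathbb{R}$ with finite second moment, with the 2-Wasserstein metric $\mathcal W_2$ (boundedness, closedness, compactness refer to this metric). For sets, $\mathcal W_2(A,B):=\sup_{\mu\in A}\inf_{\nu\in B}\mathcal W_2(\mu,\nu)$. Stochastic order: $\mu\le_{\mathrm{st}}\nu$ iff $\int f\,\mathrm d\mu\le\int f\,\mathrm d\nu$ for all bounded increasing (non-decreasing) $f:\mathbb{R}\to\mathbb{R}$; $\mu<_{\mathrm{st}}\nu$ means $\mu\le_{\mathrm{st}}\nu$ and $\mu\neq\nu$; $[\mu,\nu]=\{\rho\in\mathcal P_2(\mathbb{R}):\mu\le_{\mathrm{st}}\rho\le_{\mathrm{st}}\nu\}$. A set is order bounded if it has both an upper and a lower bound in $\mathcal P_2(\mathbb{R})$ for $\le_{\mathrm{st}}$. A semiflow on $\mathcal P_2(\mathbb{R})$ is a (jointly) continuous map $P^*:\mathbb{R}_+\times\mathcal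 P_2(\mathbb{R})\to\mathcal P_2(\mathbb{R})$, $(t,\mu)\mapsto P_t^*\mu$, with $P_0^*=\mathrm{id}$ and $P_t^*\circ P_s^*=P_{t+s}^*$. It is order-preserving if $\mu\le_{\mathrm{st}}\nu$ implies $P_t^*\mu\le_{\mathrm{st}}P_t^*\nu$ for all $t>0$. $\nu$ is an invariant measure if $P_t^*\nu=\nu$ for all $t\ge0$. A set $A$ is invariant if $P_t^*A=A$ for all $t\ge0$, and eventually positively invariant if there is $t_0\ge0$ with $P_t^*A\subset A$ for all $t\ge t_0$. A set $K$ (or measure, identified with a singleton) attracts a set $B$ (or measure) if $\mathcal W_2(P_t^*B,K)\to0$ as $t\to\infty$. The global attractor is a compact invariant set that attracts each bounded subset of $\mathcal P_2(\mathbb{R})$ (unique if it exists). $\omega(B):=\bigcap_{s\ge0}\overline{\bigcup_{t\ge s}P_t^*B}$. *)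

theory Defs
  imports "HOL-Probability.Probability"
begin

section \<open>The 2-Wasserstein space over the real line\<close>

definition P2 :: "real measure set" where
  "P2 = {\<mu>. prob_space \<mu> \<and> sets \<mu> = sets borel \<and> integrable \<mu> (\<lambda>x. x\<^sup>2)}"

definition couplings :: "real measure \<Rightarrow> real measure \<Rightarrow> (real \<times> real) measure set" where
  "couplings \<mu> \<nu> = {\<gamma>. prob_space \<gamma> \<and> sets \<gamma> = sets (borel \<Otimes>\<^sub>M borel) \<and>
     distr \<gamma> borel fst = \<mu> \<and> distr \<gamma> borel snd = \<nu>}"

text \<open>The transport cost is finite for \<open>\<mu>, \<nu> \<in> P2\<close>, so \<^const>\<open>enn2real\<close> loses nothing there.\<close>

definition W2 :: "real measure \<Rightarrow> real measure \<Rightarrow> real" where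
  "W2 \<mu> \<nu> =
     sqrt (enn2real (INF \<gamma>\<in>couplings \<mu> \<nu>. \<integral>\<^sup>+ p. ennreal ((fst p - snd p)\<^sup>2) \<partial>\<gamma>))"

abbreviation W2_topology :: "real measure topology" where
  "W2_topology \<equiv> Metric_space.mtopology P2 W2"

abbreviation W2_bounded :: "real measure set \<Rightarrow> bool" where
  "W2_bounded \<equiv> Metric_space.mbounded P2 W2"

text \<open>The one-sided distance between sets. It may be infinite, and it is taken in
  \<^typ>\<open>ennreal\<close> so that \<open>sup {} = 0\<close> and \<open>inf {} = \<infinity>\<close>.\<close>

definition W2_set :: "real measure set \<Rightarrow> real measure set \<Rightarrow> ennreal" where
  "W2_set A B = (SUP \<mu>\<in>A. INF \<nu>\<in>B. ennreal (W2 \<mu> \<nu>))"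

section \<open>Stochastic order\<close>

definition st_le :: "real measure \<Rightarrow> real measure \<Rightarrow> bool" (infix "\<le>\<^sub>s\<^sub>t" 50) where
  "\<mu> \<le>\<^sub>s\<^sub>t \<nu> \<longleftrightarrow> (\<forall>f :: real \<Rightarrow> real. mono f \<and> bounded (range f) \<longrightarrow>
     integral\<^sup>L \<mu> f \<le> integral\<^sup>L \<nu> f)"

definition st_less :: "real measure \<Rightarrow> real measure \<Rightarrow> bool" (infix "<\<^sub>s\<^sub>t" 50) where
  "\<mu> <\<^sub>s\<^sub>t \<nu> \<longleftrightarrow> \<mu> \<le>\<^sub>s\<^sub>t \<nu> \<and> \<mu> \<noteq> \<nu>"

definition st_interval :: "real measure \<Rightarrow> real measure \<Rightarrow> real measure set" where
  "st_interval \<mu> \<nu> = {\<rho> \<in> P2. \<mu> \<le>\<^sub>s\<^sub>t \<rho> \<and> \<rho> \<le>\<^sub>s\<^sub>t \<nu>}"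

definition order_bounded :: "real measure set \<Rightarrow> bool" where
  "order_bounded A \<longleftrightarrow>
     (\<exists>u\<in>P2. \<forall>\<mu>\<in>A. \<mu> \<le>\<^sub>s\<^sub>t u) \<and> (\<exists>l\<in>P2. \<forall>\<mu>\<in>A. l \<le>\<^sub>s\<^sub>t \<mu>)"

section \<open>Semiflows\<close>

text \<open>A semiflow is given by a total function \<open>P\<close>; its values \<open>P t \<mu>\<close> for \<open>t < 0\<close> or
  \<open>\<mu> \<notin> P2\<close> are irrelevant. That \<open>P t\<close> maps \<^const>\<open>P2\<close> to itself for \<open>t \<ge> 0\<close> is part of
  \<^const>\<open>continuous_map\<close>.\<close>

definition semiflow :: "(real \<Rightarrow> real measure \<Rightarrow> real measure) \<Rightarrow> bool" where
  "semiflow P \<longleftrightarrow>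
     continuous_map (prod_topology (top_of_set {0..}) W2_topology) W2_topology
       (\<lambda>(t, \<mu>). P t \<mu>) \<and>
     (\<forall>\<mu>\<in>P2. P 0 \<mu> = \<mu>) \<and>
     (\<forall>t\<ge>0. \<forall>s\<ge>0. \<forall>\<mu>\<in>P2. P t (P s \<mu>) = P (t + s) \<mu>)"

definition order_preserving :: "(real \<Rightarrow> real measure \<Rightarrow> real measure) \<Rightarrow> bool" where
  "order_preserving P \<longleftrightarrow>
     (\<forall>\<mu>\<in>P2. \<forall>\<nu>\<in>P2. \<mu> \<le>\<^sub>s\<^sub>t \<nu> \<longrightarrow> (\<forall>t>0. P t \<mu> \<le>\<^sub>s\<^sub>t P t \<nu>))"

definition invariant_measure ::
    "(real \<Rightarrow> real measure \<Rightarrow> real measure) \<Rightarrow> real measure \<Rightarrow> bool" where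
  "invariant_measure P \<nu> \<longleftrightarrow> \<nu> \<in> P2 \<and> (\<forall>t\<ge>0. P t \<nu> = \<nu>)"

definition invariant_set ::
    "(real \<Rightarrow> real measure \<Rightarrow> real measure) \<Rightarrow> real measure set \<Rightarrow> bool" where
  "invariant_set P A \<longleftrightarrow> A \<subseteq> P2 \<and> (\<forall>t\<ge>0. P t ` A = A)"

definition eventually_positively_invariant ::
    "(real \<Rightarrow> real measure \<Rightarrow> real measure) \<Rightarrow> real measure set \<Rightarrow> bool" where
  "eventually_positively_invariant P A \<longleftrightarrow>
     A \<subseteq> P2 \<and> (\<exists>t0\<ge>0. \<forall>t\<ge>t0. P t ` A \<subseteq> A)"

definition attracts ::
    "(real \<Rightarrow> real measure \<Rightarrow> real measure) \<Rightarrow> real measure set \<Rightarrow> real measure set \<Rightarrow> bool" where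
  "attracts P K B \<longleftrightarrow> ((\<lambda>t. W2_set (P t ` B) K) \<longlongrightarrow> 0) at_top"

definition global_attractor ::
    "(real \<Rightarrow> real measure \<Rightarrow> real measure) \<Rightarrow> real measure set \<Rightarrow> bool" where
  "global_attractor P A \<longleftrightarrow>
     compactin W2_topology A \<and> invariant_set P A \<and> (\<forall>B. W2_bounded B \<longrightarrow> attracts P A B)"

definition omega_limit ::
    "(real \<Rightarrow> real measure \<Rightarrow> real measure) \<Rightarrow> real measure set \<Rightarrow> real measure set" where
  "omega_limit P B = (\<Inter>s\<in>{0..}. W2_topology closure_of (\<Union>t\<in>{s..}. P t ` B))"

end

theory Submission
  imports Defs
begin

text \<open>On the line, \<open>(x - y)\<^sup>2\<close> is twice the area of the triangle of pairs \<open>s \<le> t\<close> separating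
  \<open>x\<close> from \<open>y\<close>. Integrating this over a coupling and bounding the probability of each separation from
  below in terms of the distribution functions shows that the coupling by quantile functions is
  optimal. Hence \<open>W2\<close> is the \<open>L\<^sup>2\<close> distance of quantile functions, the stochastic order is their
  pointwise order and is closed, and order intervals are compact by Helly's theorem and dominated
  convergence.

  So \<open>K\<close> is compact, and the limit set of every attracted set is compact, invariant and attracting.
  If \<open>u\<close> is an upper bound of \<open>K\<close>, invariance of \<open>\<omega>(K)\<close> and monotonicity put every element of
  \<open>\<omega>({u}) \<subseteq> \<omega>(K)\<close> above all of \<open>\<omega>(K)\<close>. By antisymmetry \<open>\<omega>({u})\<close> is a single point, which
  is the largest element of \<open>\<omega>(K)\<close> and is invariant. An orbit that dominates one converging to
  this element has limit set in \<open>\<omega>(K)\<close> above it, hence converges to it as well.\<close>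

section \<open>Transport cost and distribution functions\<close>

text \<open>By Fubini, the slice over \<open>s\<close> is \<open>{s..<y}\<close>, so the area is the
  integral of \<open>y - s\<close> over \<open>{x..y}\<close>.\<close>

lemma emeasure_lborel_triangle:
  fixes x y :: real
  assumes "x \<le> y"
  shows "2 * emeasure (lborel \<Otimes>\<^sub>M lborel) {(s, t). s \<le> t \<and> x \<le> s \<and> t < y} = ennreal ((x - y)\<^sup>2)"
proof -
  let ?A = "{(s, t). s \<le> t \<and> x \<le> s \<and> t < y}"
  have "?A = {p \<in> space (borel \<Otimes>\<^sub>M borel). fst p \<le> snd p \<and> x \<le> fst p \<and> snd p < y}"
    by (auto simp: space_pair_measure)
  also have "\<dots> \<in> sets (borel \<Otimes>\<^sub>M borel)"
    by measurable
  finally have A: "?A \<in> sets (lborel \<Otimes>\<^sub>M lborel)"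
    by simp
  have "emeasure (lborel \<Otimes>\<^sub>M lborel) ?A = (\<integral>\<^sup>+s. emeasure lborel (Pair s -` ?A) \<partial>lborel)"
    by (rule lborel.emeasure_pair_measure_alt[OF A])
  also have "\<dots> = (\<integral>\<^sup>+s. ennreal (y - s) * indicator {x..y} s \<partial>lborel)"
  proof (intro nn_integral_cong)
    fix s
    have "Pair s -` ?A = (if s \<in> {x..y} then {s..<y} else {})"
      by auto
    then show "emeasure lborel (Pair s -` ?A) = ennreal (y - s) * indicator {x..y} s"
      by auto
  qed
  also have "\<dots> = ennreal (- ((y - y)\<^sup>2 / 2) - (- ((y - x)\<^sup>2 / 2)))"
    using assms
    by (intro nn_integral_FTC_Icc[where F = "\<lambda>s. - ((y - s)\<^sup>2 / 2)"])
      (auto intro!: derivative_eq_intros simp: field_simps)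
  finally show ?thesis
    by (simp add: ennreal_mult[symmetric] power2_commute flip: ennreal_numeral)
qed

text \<open>The mix of weak and strict inequalities fits the cdf convention: for quantile functions
  on (0,1), each alternative confines \<open>\<omega>\<close> to a half-open interval between values
  of the two cdfs.\<close>

definition separating :: "real \<Rightarrow> real \<Rightarrow> real \<times> real \<Rightarrow> bool" where
  "separating x y = (\<lambda>(s, t). s \<le> t \<and> (x \<le> s \<and> t < y \<or> y \<le> s \<and> t < x))"

lemma emeasure_separating:
  "2 * emeasure (lborel \<Otimes>\<^sub>M lborel) {p. separating x y p} = ennreal ((x - y)\<^sup>2)"
proof (cases x y rule: linorder_cases)
  case less
  then have "{p. separating x y p} = {(s, t). s \<le> t \<and> x \<le> s \<and> t < y}"
    by (auto simp: separating_def)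
  with less show ?thesis
    using emeasure_lborel_triangle[of x y] by simp
next
  case greater
  then have "{p. separating x y p} = {(s, t). s \<le> t \<and> y \<le> s \<and> t < x}"
    by (auto simp: separating_def)
  with greater show ?thesis
    using emeasure_lborel_triangle[of y x] by (simp add: power2_commute)
next
  case equal
  then have "separating x y = (\<lambda>_. False)"
    by (auto simp: separating_def)
  with equal show ?thesis
    by simp
qed

lemma measurable_separating [measurable]:
  assumes [measurable]: "f \<in> borel_measurable M" "g \<in> borel_measurable M" "h \<in> M \<rightarrow>\<^sub>M borel \<Otimes>\<^sub>M borel"
  shows "Measurable.pred M (\<lambda>z. separating (f z) (g z) (h z))"
  unfolding separating_def split_beta by measurable

text \<open>Tonelli's theorem, after \<open>emeasure_separating\<close> has replaced the squared
  difference by an area. The general \<open>M\<close> lets the formula serve both the unit interval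
  and an arbitrary coupling.\<close>

lemma (in sigma_finite_measure) nn_integral_cost:
  fixes X Y :: "'a \<Rightarrow> real"
  assumes X [measurable]: "X \<in> borel_measurable M" and Y [measurable]: "Y \<in> borel_measurable M"
  shows "(\<integral>\<^sup>+\<omega>. ennreal ((X \<omega> - Y \<omega>)\<^sup>2) \<partial>M) =
    2 * (\<integral>\<^sup>+p. emeasure M {\<omega> \<in> space M. separating (X \<omega>) (Y \<omega>) p} \<partial>(lborel \<Otimes>\<^sub>M lborel))"
proof -
  interpret L: sigma_finite_measure "lborel \<Otimes>\<^sub>M lborel :: (real \<times> real) measure"
    by (rule sigma_finite_pair_measure) standard
  interpret P: pair_sigma_finite M "lborel \<Otimes>\<^sub>M lborel :: (real \<times> real) measure" ..
  have [measurable]: "Measurable.pred (M \<Otimes>\<^sub>M (lborel \<Otimes>\<^sub>M lborel))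
      (\<lambda>z. separating (X (fst z)) (Y (fst z)) (snd z))"
    by measurable
  have [measurable]: "{p. separating (X \<omega>) (Y \<omega>) p} \<in> sets (borel \<Otimes>\<^sub>M borel)" for \<omega>
    using measurable_separating[of "\<lambda>_. X \<omega>" "borel \<Otimes>\<^sub>M borel" "\<lambda>_. Y \<omega>" "\<lambda>p. p"]
    by (simp add: pred_def space_pair_measure)
  \<comment> \<open>As an integral of the indicator of one set in the product space, the area leads
    to an iterated integral that Fubini can reorder.\<close>
  have area: "emeasure (lborel \<Otimes>\<^sub>M lborel) {p. separating (X \<omega>) (Y \<omega>) p} =
      (\<integral>\<^sup>+p. indicator {z. separating (X (fst z)) (Y (fst z)) (snd z)} (\<omega>, p) \<partial>(lborel \<Otimes>\<^sub>M lborel))" for \<omega>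
  proof -
    have "emeasure (lborel \<Otimes>\<^sub>M lborel) {p. separating (X \<omega>) (Y \<omega>) p} =
        (\<integral>\<^sup>+p. indicator {p. separating (X \<omega>) (Y \<omega>) p} p \<partial>(lborel \<Otimes>\<^sub>M lborel))"
      by (rule nn_integral_indicator[symmetric]) simp
    also have "\<dots> = (\<integral>\<^sup>+p. indicator {z. separating (X (fst z)) (Y (fst z)) (snd z)} (\<omega>, p) \<partial>(lborel \<Otimes>\<^sub>M lborel))"
      by (intro nn_integral_cong) (simp add: indicator_def)
    finally show ?thesis .
  qed
  have "(\<integral>\<^sup>+\<omega>. ennreal ((X \<omega> - Y \<omega>)\<^sup>2) \<partial>M) =
      (\<integral>\<^sup>+\<omega>. 2 * emeasure (lborel \<Otimes>\<^sub>M lborel) {p. separating (X \<omega>) (Y \<omega>) p} \<partial>M)"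
    by (simp add: emeasure_separating)
  also have "\<dots> = (\<integral>\<^sup>+\<omega>. 2 * (\<integral>\<^sup>+p. indicator {z. separating (X (fst z)) (Y (fst z)) (snd z)} (\<omega>, p)
      \<partial>(lborel \<Otimes>\<^sub>M lborel)) \<partial>M)"
    unfolding area ..
  also have "\<dots> = 2 * (\<integral>\<^sup>+\<omega>. (\<integral>\<^sup>+p. indicator {z. separating (X (fst z)) (Y (fst z)) (snd z)} (\<omega>, p)
      \<partial>(lborel \<Otimes>\<^sub>M lborel)) \<partial>M)"
    by (intro nn_integral_cmult) measurable
  also have "\<dots> = 2 * (\<integral>\<^sup>+p. (\<integral>\<^sup>+\<omega>. indicator {z. separating (X (fst z)) (Y (fst z)) (snd z)} (\<omega>, p)
      \<partial>M) \<partial>(lborel \<Otimes>\<^sub>M lborel))"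
    by (subst P.Fubini') auto
  also have "\<dots> = 2 * (\<integral>\<^sup>+p. emeasure M {\<omega> \<in> space M. separating (X \<omega>) (Y \<omega>) p} \<partial>(lborel \<Otimes>\<^sub>M lborel))"
    by (intro nn_integral_cong arg_cong2[where f = "(*)"] refl)
      (subst nn_integral_indicator[symmetric];
       auto intro!: nn_integral_cong simp: indicator_def)
  finally show ?thesis .
qed

section \<open>Quantile functions\<close>

text \<open>The generalized inverse of the cdf. Only \<open>\<omega>\<close> strictly between 0 and
  1 is meaningful: at 0 the set is the whole line, and at 1 it can be empty.\<close>

definition quantile :: "real measure \<Rightarrow> real \<Rightarrow> real" where
  "quantile \<mu> \<omega> = Inf {x. \<omega> \<le> cdf \<mu> x}"

abbreviation unit_interval :: "real measure" where
  "unit_interval \<equiv> restrict_space lborel {0<..<1}"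

interpretation unit_interval: prob_space unit_interval
  by (auto simp add: emeasure_restrict_space space_restrict_space intro!: prob_spaceI)

lemma real_distribution_P2:
  assumes "\<mu> \<in> P2"
  shows "real_distribution \<mu>"
proof -
  interpret prob_space \<mu>
    using assms by (simp add: P2_def)
  show ?thesis
    using assms by unfold_locales (auto simp: P2_def)
qed

context
  fixes \<mu> :: "real measure"
  assumes \<mu>: "real_distribution \<mu>"
begin

interpretation cdf_distribution \<mu>
  using \<mu> by (simp add: cdf_distribution_def)

text \<open>Right continuity of the cdf makes the infimum an attained minimum. This Galois
  connection translates between events in \<open>\<omega>\<close> and values of cdfs.\<close>

lemma quantile_le_iff:
  assumes "\<omega> \<in> {0<..<1}"
  shows "quantile \<mu> \<omega> \<le> x \<longleftrightarrow> \<omega> \<le> cdf \<mu> x"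
  using pseudoinverse[of \<omega> x] assms by (simp add: quantile_def)

lemma less_quantile_iff:
  assumes "\<omega> \<in> {0<..<1}"
  shows "x < quantile \<mu> \<omega> \<longleftrightarrow> cdf \<mu> x < \<omega>"
  using quantile_le_iff[OF assms, of x] by linarith

lemma measurable_quantile: "quantile \<mu> \<in> borel_measurable unit_interval"
proof -
  have "quantile \<mu> \<in> borel_measurable (restrict_space borel {0<..<1})"
    using measurable_CI by (simp add: quantile_def[abs_def])
  also have "borel_measurable (restrict_space borel {0<..<1}) = borel_measurable unit_interval"
    by (intro measurable_cong_sets sets_restrict_space_cong) auto
  finally show ?thesis .
qed

text \<open>Inverse transform sampling; it realizes all distributions on one probability space,
  where they can be compared pointwise.\<close>

lemma distr_quantile: "distr unit_interval borel (quantile \<mu>) = \<mu>"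
  using distr_I_eq_M by (simp add: quantile_def[abs_def])

end

text \<open>By \<open>nn_integral_cost\<close>, twice the integral of this function is the cost of the coupling given
  by the quantile functions; \<open>ennreal\<close> truncates negative differences to \<open>0\<close>.\<close>

definition monotone_cost :: "real measure \<Rightarrow> real measure \<Rightarrow> real \<times> real \<Rightarrow> ennreal" where
  "monotone_cost \<mu> \<nu> = (\<lambda>(s, t). if s \<le> t
     then ennreal (cdf \<mu> s - cdf \<nu> t) + ennreal (cdf \<nu> s - cdf \<mu> t) else 0)"

lemma measurable_monotone_cost [measurable]:
  assumes "real_distribution \<mu>" "real_distribution \<nu>"
  shows "monotone_cost \<mu> \<nu> \<in> borel_measurable (borel \<Otimes>\<^sub>M borel)"
proof -
  have [measurable]: "cdf \<mu> \<in> borel_measurable borel" "cdf \<nu> \<in> borel_measurable borel"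
    using assms[THEN cdf_distribution.intro] by (auto intro: cdf_distribution.measurable_C)
  show ?thesis
    unfolding monotone_cost_def split_beta by measurable
qed

text \<open>By the Galois connection, separation by \<open>(s, t)\<close> with
  \<open>s \<le> t\<close> forces \<open>\<omega>\<close> into one of two half-open intervals, whose
  lengths are the two summands of \<open>monotone_cost\<close>.\<close>

lemma emeasure_separating_quantile_le:
  assumes \<mu>: "real_distribution \<mu>" and \<nu>: "real_distribution \<nu>"
  shows "emeasure unit_interval {\<omega> \<in> space unit_interval. separating (quantile \<mu> \<omega>) (quantile \<nu> \<omega>) p}
    \<le> monotone_cost \<mu> \<nu> p"
proof (cases p)
  case (Pair s t)
  have *: "emeasure lborel {a<..b} \<le> ennreal (b - a)" for a b :: real
    by (cases "a \<le> b") auto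
  have "emeasure unit_interval {\<omega> \<in> space unit_interval. separating (quantile \<mu> \<omega>) (quantile \<nu> \<omega>) p}
      = emeasure lborel {\<omega> \<in> {0<..<1}. separating (quantile \<mu> \<omega>) (quantile \<nu> \<omega>) p}"
    by (subst emeasure_restrict_space) (auto simp: space_restrict_space)
  also have "\<dots> \<le> (if s \<le> t then emeasure lborel ({cdf \<nu> t<..cdf \<mu> s} \<union> {cdf \<mu> t<..cdf \<nu> s}) else 0)"
    using \<mu> \<nu> by (auto simp: Pair separating_def quantile_le_iff less_quantile_iff
      intro!: emeasure_mono)
  also have "\<dots> \<le> monotone_cost \<mu> \<nu> p"
    by (auto simp: Pair monotone_cost_def intro!: emeasure_subadditive[THEN order_trans] add_mono *)
  finally show ?thesis .
qed

text \<open>For a pair \<open>(X, Y)\<close> with law \<open>\<gamma>\<close>,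
  \<open>X \<le> s\<close> implies that \<open>Y \<le> t\<close> or that \<open>X \<le> s\<close>
  and \<open>t < Y\<close>. Taking probabilities bounds the first summand, and exchanging
  \<open>X\<close> and \<open>Y\<close> bounds the second.\<close>

lemma monotone_cost_le:
  assumes "\<gamma> \<in> couplings \<mu> \<nu>"
  shows "monotone_cost \<mu> \<nu> p \<le> emeasure \<gamma> {q \<in> space \<gamma>. separating (fst q) (snd q) p}"
proof (cases p)
  case (Pair s t)
  interpret prob_space \<gamma>
    using assms by (simp add: couplings_def)
  have sets [measurable_cong]: "sets \<gamma> = sets (borel \<Otimes>\<^sub>M borel)"
    and \<mu>: "\<mu> = distr \<gamma> borel fst" and \<nu>: "\<nu> = distr \<gamma> borel snd"
    using assms by (auto simp: couplings_def)
  have space: "space \<gamma> = UNIV"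
    using sets_eq_imp_space_eq[OF sets] by (simp add: space_pair_measure)
  have cdf: "cdf \<mu> x = prob {q. fst q \<le> x}" "cdf \<nu> x = prob {q. snd q \<le> x}" for x
    by (auto simp: \<mu> \<nu> cdf_def measure_distr space intro!: arg_cong[where f = prob])
  have [measurable]: "{q. fst q \<le> x \<and> y < snd q} \<in> sets \<gamma>" "{q. snd q \<le> x \<and> y < fst q} \<in> sets \<gamma>"
    "{q. fst q \<le> x} \<in> sets \<gamma>" "{q. snd q \<le> x} \<in> sets \<gamma>" for x y :: real
  proof -
    have "{q \<in> space \<gamma>. fst q \<le> x \<and> y < snd q} \<in> sets \<gamma>" "{q \<in> space \<gamma>. snd q \<le> x \<and> y < fst q} \<in> sets \<gamma>"
      "{q \<in> space \<gamma>. fst q \<le> x} \<in> sets \<gamma>" "{q \<in> space \<gamma>. snd q \<le> x} \<in> sets \<gamma>"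
      by measurable
    then show "{q. fst q \<le> x \<and> y < snd q} \<in> sets \<gamma>" "{q. snd q \<le> x \<and> y < fst q} \<in> sets \<gamma>"
      "{q. fst q \<le> x} \<in> sets \<gamma>" "{q. snd q \<le> x} \<in> sets \<gamma>"
      by (simp_all add: space)
  qed
  show ?thesis
  proof (cases "s \<le> t")
    case True
    have "prob {q. fst q \<le> s} \<le> prob ({q. fst q \<le> s \<and> t < snd q} \<union> {q. snd q \<le> t})"
      by (intro finite_measure_mono) auto
    also have "\<dots> \<le> prob {q. fst q \<le> s \<and> t < snd q} + prob {q. snd q \<le> t}"
      by (intro measure_Un_le) auto
    finally have 1: "cdf \<mu> s - cdf \<nu> t \<le> prob {q. fst q \<le> s \<and> t < snd q}"
      by (simp add: cdf)
    have "prob {q. snd q \<le> s} \<le> prob ({q. snd q \<le> s \<and> t < fst q} \<union> {q. fst q \<le> t})"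
      by (intro finite_measure_mono) auto
    also have "\<dots> \<le> prob {q. snd q \<le> s \<and> t < fst q} + prob {q. fst q \<le> t}"
      by (intro measure_Un_le) auto
    finally have 2: "cdf \<nu> s - cdf \<mu> t \<le> prob {q. snd q \<le> s \<and> t < fst q}"
      by (simp add: cdf)
    have "monotone_cost \<mu> \<nu> p \<le> emeasure \<gamma> {q. fst q \<le> s \<and> t < snd q} +
        emeasure \<gamma> {q. snd q \<le> s \<and> t < fst q}"
      using 1 2 True by (auto simp: Pair monotone_cost_def emeasure_eq_measure intro!: add_mono ennreal_leI)
    \<comment> \<open>The two events are disjoint because \<open>s \<le> t\<close> excludes
      \<open>fst q \<le> s\<close> together with \<open>t < fst q\<close>.\<close>
    also have "\<dots> = emeasure \<gamma> ({q. fst q \<le> s \<and> t < snd q} \<union> {q. snd q \<le> s \<and> t < fst q})"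
      using True by (intro plus_emeasure) auto
    also have "\<dots> = emeasure \<gamma> {q \<in> space \<gamma>. separating (fst q) (snd q) p}"
      using True by (auto simp: Pair separating_def space intro!: arg_cong[where f = "emeasure \<gamma>"])
    finally show ?thesis .
  qed (simp add: Pair monotone_cost_def)
qed

lemma quantile_coupling:
  assumes \<mu>: "real_distribution \<mu>" and \<nu>: "real_distribution \<nu>"
  shows "distr unit_interval (borel \<Otimes>\<^sub>M borel) (\<lambda>\<omega>. (quantile \<mu> \<omega>, quantile \<nu> \<omega>)) \<in> couplings \<mu> \<nu>"
proof -
  note [measurable] = measurable_quantile[OF \<mu>] measurable_quantile[OF \<nu>]
  show ?thesis
    by (auto simp: couplings_def distr_distr comp_def distr_quantile \<mu> \<nu>
        intro!: unit_interval.prob_space_distr)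
qed

text \<open>The inequalities \<open>?J \<le> ?Q \<le> ?D \<le> ?J\<close> close into a circle: the
  quantile coupling competes in the infimum, its cost is at most \<open>?D\<close>, and every
  coupling costs at least \<open>?D\<close>. Hence the quantile coupling is optimal.\<close>

lemma
  assumes \<mu>: "real_distribution \<mu>" and \<nu>: "real_distribution \<nu>"
  shows nn_integral_quantile:
      "(\<integral>\<^sup>+\<omega>. ennreal ((quantile \<mu> \<omega> - quantile \<nu> \<omega>)\<^sup>2) \<partial>unit_interval) =
        2 * (\<integral>\<^sup>+p. monotone_cost \<mu> \<nu> p \<partial>(lborel \<Otimes>\<^sub>M lborel))"
    and INF_couplings:
      "(INF \<gamma>\<in>couplings \<mu> \<nu>. \<integral>\<^sup>+p. ennreal ((fst p - snd p)\<^sup>2) \<partial>\<gamma>) =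
        2 * (\<integral>\<^sup>+p. monotone_cost \<mu> \<nu> p \<partial>(lborel \<Otimes>\<^sub>M lborel))"
proof -
  let ?J = "INF \<gamma>\<in>couplings \<mu> \<nu>. \<integral>\<^sup>+p. ennreal ((fst p - snd p)\<^sup>2) \<partial>\<gamma>"
  let ?Q = "\<integral>\<^sup>+\<omega>. ennreal ((quantile \<mu> \<omega> - quantile \<nu> \<omega>)\<^sup>2) \<partial>unit_interval"
  let ?D = "2 * (\<integral>\<^sup>+p. monotone_cost \<mu> \<nu> p \<partial>(lborel \<Otimes>\<^sub>M lborel))"
  note [measurable] = measurable_quantile[OF \<mu>] measurable_quantile[OF \<nu>]
  have "?J \<le> (\<integral>\<^sup>+p. ennreal ((fst p - snd p)\<^sup>2)
      \<partial>distr unit_interval (borel \<Otimes>\<^sub>M borel) (\<lambda>\<omega>. (quantile \<mu> \<omega>, quantile \<nu> \<omega>)))"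
    by (rule INF_lower[OF quantile_coupling[OF \<mu> \<nu>]])
  also have "\<dots> = ?Q"
    by (subst nn_integral_distr) auto
  finally have JQ: "?J \<le> ?Q" .
  have QD: "?Q \<le> ?D"
    unfolding unit_interval.nn_integral_cost[OF measurable_quantile[OF \<mu>] measurable_quantile[OF \<nu>]]
    by (intro mult_left_mono nn_integral_mono emeasure_separating_quantile_le \<mu> \<nu>) auto
  have DJ: "?D \<le> ?J"
  proof (rule INF_greatest)
    fix \<gamma> assume \<gamma>: "\<gamma> \<in> couplings \<mu> \<nu>"
    then interpret \<gamma>: prob_space \<gamma>
      by (simp add: couplings_def)
    have [measurable_cong]: "sets \<gamma> = sets (borel \<Otimes>\<^sub>M borel)"
      using \<gamma> by (simp add: couplings_def)
    show "?D \<le> (\<integral>\<^sup>+p. ennreal ((fst p - snd p)\<^sup>2) \<partial>\<gamma>)"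
      by (subst \<gamma>.nn_integral_cost)
        (auto intro!: mult_left_mono nn_integral_mono monotone_cost_le \<gamma>)
  qed
  show "?Q = ?D"
    using QD DJ JQ by auto
  show "?J = ?D"
    using QD DJ JQ by auto
qed

section \<open>The Wasserstein metric\<close>

lemma W2_eq_monotone_cost:
  assumes "real_distribution \<mu>" "real_distribution \<nu>"
  shows "W2 \<mu> \<nu> = sqrt (enn2real (2 * (\<integral>\<^sup>+p. monotone_cost \<mu> \<nu> p \<partial>(lborel \<Otimes>\<^sub>M lborel))))"
  by (simp add: W2_def INF_couplings[OF assms])

lemma integrable_quantile_square:
  assumes "\<mu> \<in> P2"
  shows "integrable unit_interval (\<lambda>\<omega>. (quantile \<mu> \<omega>)\<^sup>2)"
proof -
  note \<mu> = real_distribution_P2[OF assms]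
  have "integrable (distr unit_interval borel (quantile \<mu>)) (\<lambda>x. x\<^sup>2)"
    using assms by (simp add: distr_quantile[OF \<mu>] P2_def)
  then show ?thesis
    by (simp add: integrable_distr_eq measurable_quantile[OF \<mu>])
qed

lemma P2_iff_integrable_quantile:
  assumes \<mu>: "real_distribution \<mu>"
  shows "\<mu> \<in> P2 \<longleftrightarrow> integrable unit_interval (\<lambda>\<omega>. (quantile \<mu> \<omega>)\<^sup>2)"
proof -
  interpret real_distribution \<mu> by fact
  have "\<mu> \<in> P2 \<longleftrightarrow> integrable (distr unit_interval borel (quantile \<mu>)) (\<lambda>x. x\<^sup>2)"
    by (simp add: distr_quantile[OF \<mu>] P2_def prob_space_axioms)
  then show ?thesis
    by (simp add: integrable_distr_eq measurable_quantile[OF \<mu>])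
qed

section \<open>Cauchy-Schwarz and Minkowski inequalities for square-integrable functions\<close>

lemma integrable_square_add:
  fixes f g :: "'a \<Rightarrow> real"
  assumes [measurable]: "f \<in> borel_measurable M" "g \<in> borel_measurable M"
    and fg: "integrable M (\<lambda>x. (f x)\<^sup>2)" "integrable M (\<lambda>x. (g x)\<^sup>2)"
  shows "integrable M (\<lambda>x. (f x + g x)\<^sup>2)"
proof (rule Bochner_Integration.integrable_bound)
  show "integrable M (\<lambda>x. 2 * (f x)\<^sup>2 + 2 * (g x)\<^sup>2)"
    using fg by simp
  have "(a + b)\<^sup>2 \<le> 2 * a\<^sup>2 + 2 * b\<^sup>2" for a b :: real
    using zero_le_power2[of "a - b"] by (simp add: power2_eq_square algebra_simps)
  then show "AE x in M. norm ((f x + g x)\<^sup>2) \<le> norm (2 * (f x)\<^sup>2 + 2 * (g x)\<^sup>2)"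
    by simp
qed simp

lemma integrable_mult_square:
  fixes f g :: "'a \<Rightarrow> real"
  assumes [measurable]: "f \<in> borel_measurable M" "g \<in> borel_measurable M"
    and fg: "integrable M (\<lambda>x. (f x)\<^sup>2)" "integrable M (\<lambda>x. (g x)\<^sup>2)"
  shows "integrable M (\<lambda>x. f x * g x)"
proof -
  have "integrable M (\<lambda>x. ((f x + g x)\<^sup>2 - (f x)\<^sup>2 - (g x)\<^sup>2) / 2)"
    using integrable_square_add[OF assms] fg by simp
  then show ?thesis
    by (simp add: power2_sum)
qed

text \<open>The quadratic form \<open>quad\<close> in \<open>s\<close> and \<open>t\<close> is an
  integral of a square, hence nonnegative; evaluating it at suitable points gives the bound on
  \<open>B\<close>.\<close>

lemma Cauchy_Schwarz_integral:
  fixes f g :: "'a \<Rightarrow> real"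
  assumes [measurable]: "f \<in> borel_measurable M" "g \<in> borel_measurable M"
    and fg: "integrable M (\<lambda>x. (f x)\<^sup>2)" "integrable M (\<lambda>x. (g x)\<^sup>2)"
  shows "(LINT x|M. f x * g x) \<le> sqrt (LINT x|M. (f x)\<^sup>2) * sqrt (LINT x|M. (g x)\<^sup>2)"
proof -
  define A B C where "A = (LINT x|M. (f x)\<^sup>2)" and "B = (LINT x|M. f x * g x)"
    and "C = (LINT x|M. (g x)\<^sup>2)"
  note int = integrable_mult_square[OF assms] fg
  have nonneg: "A \<ge> 0" "C \<ge> 0"
    by (auto simp: A_def C_def)
  have quad: "0 \<le> s\<^sup>2 * A - 2 * s * t * B + t\<^sup>2 * C" for s t
  proof -
    have "0 \<le> (LINT x|M. (s * f x - t * g x)\<^sup>2)"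
      by simp
    also have "\<dots> = (LINT x|M. s\<^sup>2 * (f x)\<^sup>2 - 2 * s * t * (f x * g x) + t\<^sup>2 * (g x)\<^sup>2)"
      by (simp add: power2_diff power_mult_distrib algebra_simps)
    also have "\<dots> = s\<^sup>2 * A - 2 * s * t * B + t\<^sup>2 * C"
      using int by (simp add: A_def B_def C_def)
    finally show ?thesis .
  qed
  have "B\<^sup>2 \<le> A * C"
  proof (cases "C = 0")
    case True
    have "B = 0"
      \<comment> \<open>If \<open>C = 0\<close> and \<open>B\<close> is nonzero, the form takes the
        value \<open>A - (A + 1) = - 1\<close> here.\<close>
      using quad[of 1 "(A + 1) / (2 * B)"] True by (cases "B = 0") auto
    then show ?thesis
      using nonneg by simp
  next
    case False
    have "0 \<le> C * (A * C - B\<^sup>2)"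
      using quad[of C B] by (simp add: power2_eq_square algebra_simps)
    with False nonneg show ?thesis
      by (simp add: zero_le_mult_iff)
  qed
  then have "\<bar>B\<bar> \<le> sqrt (A * C)"
    using real_sqrt_le_mono[of "B\<^sup>2" "A * C"] by simp
  then show ?thesis
    by (simp add: A_def B_def C_def real_sqrt_mult)
qed

lemma Minkowski_integral:
  fixes f g :: "'a \<Rightarrow> real"
  assumes [measurable]: "f \<in> borel_measurable M" "g \<in> borel_measurable M"
    and fg: "integrable M (\<lambda>x. (f x)\<^sup>2)" "integrable M (\<lambda>x. (g x)\<^sup>2)"
  shows "sqrt (LINT x|M. (f x + g x)\<^sup>2) \<le> sqrt (LINT x|M. (f x)\<^sup>2) + sqrt (LINT x|M. (g x)\<^sup>2)"
proof (rule real_le_lsqrt)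
  have "(LINT x|M. (f x + g x)\<^sup>2) = (LINT x|M. (f x)\<^sup>2 + (g x)\<^sup>2 + 2 * (f x * g x))"
    by (simp add: power2_sum mult_ac)
  also have "\<dots> = (LINT x|M. (f x)\<^sup>2) + (LINT x|M. (g x)\<^sup>2) + 2 * (LINT x|M. f x * g x)"
    using fg integrable_mult_square[OF assms] by simp
  also have "\<dots> \<le> (sqrt (LINT x|M. (f x)\<^sup>2) + sqrt (LINT x|M. (g x)\<^sup>2))\<^sup>2"
    using Cauchy_Schwarz_integral[OF assms] by (simp add: power2_sum)
  finally show "(LINT x|M. (f x + g x)\<^sup>2) \<le> (sqrt (LINT x|M. (f x)\<^sup>2) + sqrt (LINT x|M. (g x)\<^sup>2))\<^sup>2" .
qed simp

section \<open>Quantile functions as an isometric embedding into L^2\<close>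

lemma integrable_quantile_diff:
  assumes "\<mu> \<in> P2" "\<nu> \<in> P2"
  shows "integrable unit_interval (\<lambda>\<omega>. (quantile \<mu> \<omega> - quantile \<nu> \<omega>)\<^sup>2)"
  using integrable_square_add[of "quantile \<mu>" unit_interval "\<lambda>\<omega>. - quantile \<nu> \<omega>"]
  by (simp add: integrable_quantile_square measurable_quantile real_distribution_P2 assms)

text \<open>The infimum over couplings equals the cost of the quantile coupling, and square
  integrability makes it finite, so that \<open>enn2real\<close> is harmless.\<close>

lemma W2_eq_quantile:
  assumes "\<mu> \<in> P2" "\<nu> \<in> P2"
  shows "W2 \<mu> \<nu> = sqrt (LINT \<omega>|unit_interval. (quantile \<mu> \<omega> - quantile \<nu> \<omega>)\<^sup>2)"
proof -
  note dist = real_distribution_P2[OF assms(1)] real_distribution_P2[OF assms(2)]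
  show ?thesis
    using nn_integral_eq_integral[OF integrable_quantile_diff[OF assms]]
    by (simp add: W2_eq_monotone_cost[OF dist] nn_integral_quantile[OF dist, symmetric])
qed

lemma couplings_swap:
  assumes "\<gamma> \<in> couplings \<mu> \<nu>"
  shows "distr \<gamma> (borel \<Otimes>\<^sub>M borel) (\<lambda>p. (snd p, fst p)) \<in> couplings \<nu> \<mu>"
proof -
  interpret prob_space \<gamma>
    using assms by (simp add: couplings_def)
  have [measurable_cong]: "sets \<gamma> = sets (borel \<Otimes>\<^sub>M borel)"
    using assms by (simp add: couplings_def)
  show ?thesis
    using assms by (auto simp: couplings_def distr_distr comp_def intro!: prob_space_distr)
qed

text \<open>\<open>Metric_space\<close> requires symmetry for all arguments, also outside
  \<open>P2\<close>, so the proof swaps the coordinates of couplings and avoids quantile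
  functions.\<close>

lemma W2_commute: "W2 \<mu> \<nu> = W2 \<nu> \<mu>"
proof -
  have le: "(INF \<gamma>\<in>couplings \<mu> \<nu>. \<integral>\<^sup>+p. ennreal ((fst p - snd p)\<^sup>2) \<partial>\<gamma>)
      \<le> (INF \<gamma>\<in>couplings \<nu> \<mu>. \<integral>\<^sup>+p. ennreal ((fst p - snd p)\<^sup>2) \<partial>\<gamma>)" for \<mu> \<nu>
  proof (rule INF_mono)
    fix \<gamma> assume \<gamma>: "\<gamma> \<in> couplings \<nu> \<mu>"
    have [measurable_cong]: "sets \<gamma> = sets (borel \<Otimes>\<^sub>M borel)"
      using \<gamma> by (simp add: couplings_def)
    have "(\<integral>\<^sup>+p. ennreal ((fst p - snd p)\<^sup>2) \<partial>distr \<gamma> (borel \<Otimes>\<^sub>M borel) (\<lambda>p. (snd p, fst p))) =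
        (\<integral>\<^sup>+p. ennreal ((fst p - snd p)\<^sup>2) \<partial>\<gamma>)"
      by (subst nn_integral_distr) (auto simp: power2_commute)
    with couplings_swap[OF \<gamma>]
    show "\<exists>\<gamma>'\<in>couplings \<mu> \<nu>. (\<integral>\<^sup>+p. ennreal ((fst p - snd p)\<^sup>2) \<partial>\<gamma>') \<le> (\<integral>\<^sup>+p. ennreal ((fst p - snd p)\<^sup>2) \<partial>\<gamma>)"
      by (intro bexI) (rule eq_refl)
  qed
  show ?thesis
    unfolding W2_def using le[of \<mu> \<nu>] le[of \<nu> \<mu>] by (simp add: antisym)
qed

interpretation W2: Metric_space P2 W2
proof
  show "0 \<le> W2 \<mu> \<nu>" for \<mu> \<nu>
    by (simp add: W2_def)
  show "W2 \<mu> \<nu> = W2 \<nu> \<mu>" for \<mu> \<nu>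
    by (rule W2_commute)
  show "W2 \<mu> \<nu> = 0 \<longleftrightarrow> \<mu> = \<nu>" if "\<mu> \<in> P2" "\<nu> \<in> P2" for \<mu> \<nu>
  proof
    note dist = real_distribution_P2[OF that(1)] real_distribution_P2[OF that(2)]
    assume "W2 \<mu> \<nu> = 0"
    then have "AE \<omega> in unit_interval. quantile \<mu> \<omega> = quantile \<nu> \<omega>"
      using integral_nonneg_eq_0_iff_AE[OF integrable_quantile_diff[OF that]]
      by (simp add: W2_eq_quantile that)
    then have "distr unit_interval borel (quantile \<mu>) = distr unit_interval borel (quantile \<nu>)"
      by (intro distr_cong_AE measurable_quantile dist) auto
    then show "\<mu> = \<nu>"
      by (simp add: distr_quantile dist)
  qed (simp add: W2_eq_quantile that)
  show "W2 \<mu> \<rho> \<le> W2 \<mu> \<nu> + W2 \<nu> \<rho>" if "\<mu> \<in> P2" "\<nu> \<in> P2" "\<rho> \<in> P2" for \<mu> \<nu> \<rho>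
    using Minkowski_integral[of "\<lambda>\<omega>. quantile \<mu> \<omega> - quantile \<nu> \<omega>" unit_interval "\<lambda>\<omega>. quantile \<nu> \<omega> - quantile \<rho> \<omega>"]
    by (simp add: W2_eq_quantile that integrable_quantile_diff measurable_quantile real_distribution_P2
        borel_measurable_diff)
qed

section \<open>The stochastic order\<close>

text \<open>The indicator of \<open>{x<..}\<close> is bounded and increasing; passing to complements
  reverses the inequality.\<close>

lemma st_leD_cdf:
  assumes \<mu>: "real_distribution \<mu>" and \<nu>: "real_distribution \<nu>" and le: "\<mu> \<le>\<^sub>s\<^sub>t \<nu>"
  shows "cdf \<nu> x \<le> cdf \<mu> x"
proof -
  interpret \<mu>: real_distribution \<mu> by fact
  interpret \<nu>: real_distribution \<nu> by fact
  have "mono (indicator {x<..} :: real \<Rightarrow> real)" "bounded (range (indicator {x<..} :: real \<Rightarrow> real))"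
    by (auto simp: mono_def indicator_def bounded_iff intro!: exI[of _ 1])
  then have "measure \<mu> {x<..} \<le> measure \<nu> {x<..}"
    using le[unfolded st_le_def, rule_format, of "indicator {x<..}"] by simp
  moreover have "{x<..} = UNIV - {..x}"
    by auto
  ultimately show ?thesis
    using \<mu>.prob_compl[of "{..x}"] \<nu>.prob_compl[of "{..x}"] by (simp add: cdf_def)
qed

lemma quantile_le_quantile:
  assumes \<mu>: "real_distribution \<mu>" and \<nu>: "real_distribution \<nu>"
    and le: "\<And>x. cdf \<nu> x \<le> cdf \<mu> x" and \<omega>: "\<omega> \<in> {0<..<1}"
  shows "quantile \<mu> \<omega> \<le> quantile \<nu> \<omega>"
  using quantile_le_iff[OF \<nu> \<omega>, of "quantile \<nu> \<omega>"] le[of "quantile \<nu> \<omega>"]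
  by (simp add: quantile_le_iff[OF \<mu> \<omega>])

text \<open>Both measures are laws of their quantile functions on the same space, and a monotone
  \<open>f\<close> preserves the pointwise order. An almost everywhere comparison is what an L^2
  limit provides.\<close>

lemma st_leI_quantile:
  assumes \<mu>: "real_distribution \<mu>" and \<nu>: "real_distribution \<nu>"
    and le: "AE \<omega> in unit_interval. quantile \<mu> \<omega> \<le> quantile \<nu> \<omega>"
  shows "\<mu> \<le>\<^sub>s\<^sub>t \<nu>"
  unfolding st_le_def
proof (intro allI impI)
  fix f :: "real \<Rightarrow> real"
  assume f: "mono f \<and> bounded (range f)"
  then have [measurable]: "f \<in> borel_measurable borel"
    by (intro borel_measurable_mono) simp
  obtain B where B: "\<And>x. \<bar>f x\<bar> \<le> B"
    using f by (auto simp: bounded_iff)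
  note [measurable] = measurable_quantile[OF \<mu>] measurable_quantile[OF \<nu>]
  have "(LINT x|distr unit_interval borel (quantile \<mu>). f x) \<le> (LINT x|distr unit_interval borel (quantile \<nu>). f x)"
    unfolding integral_distr[OF measurable_quantile[OF \<mu>] \<open>f \<in> borel_measurable borel\<close>]
      integral_distr[OF measurable_quantile[OF \<nu>] \<open>f \<in> borel_measurable borel\<close>]
  proof (rule integral_mono_AE)
    show "AE \<omega> in unit_interval. f (quantile \<mu> \<omega>) \<le> f (quantile \<nu> \<omega>)"
      using le by eventually_elim (use f in \<open>auto dest: monoD\<close>)
  qed (auto intro!: unit_interval.integrable_const_bound[where B = B] B)
  then show "integral\<^sup>L \<mu> f \<le> integral\<^sup>L \<nu> f"
    by (simp add: distr_quantile \<mu> \<nu>)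
qed

lemma st_leD_quantile:
  assumes "real_distribution \<mu>" "real_distribution \<nu>" "\<mu> \<le>\<^sub>s\<^sub>t \<nu>" "\<omega> \<in> {0<..<1}"
  shows "quantile \<mu> \<omega> \<le> quantile \<nu> \<omega>"
  using assms by (intro quantile_le_quantile st_leD_cdf)

lemma st_le_antisym:
  assumes "\<mu> \<in> P2" "\<nu> \<in> P2" "\<mu> \<le>\<^sub>s\<^sub>t \<nu>" "\<nu> \<le>\<^sub>s\<^sub>t \<mu>"
  shows "\<mu> = \<nu>"
  using assms by (intro cdf_unique ext antisym st_leD_cdf real_distribution_P2)

lemma diff_square_le: "(b - a)\<^sup>2 \<le> 2 * a\<^sup>2 + 2 * b\<^sup>2" for a b :: real
  using zero_le_power2[of "a + b"] by (simp add: power2_eq_square algebra_simps)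

text \<open>The positive part of the difference of \<open>quantile \<mu>'\<close> and
  \<open>quantile \<nu>'\<close> measures the failure of the order in the limit. Its L^2 norm is
  controlled by the distances to the two limits, hence vanishes.\<close>

lemma st_le_limit:
  assumes P2: "\<And>n. \<mu> n \<in> P2" "\<And>n. \<nu> n \<in> P2" "\<mu>' \<in> P2" "\<nu>' \<in> P2"
    and le: "\<And>n. \<mu> n \<le>\<^sub>s\<^sub>t \<nu> n"
    and lim: "(\<lambda>n. W2 (\<mu> n) \<mu>') \<longlonglongrightarrow> 0" "(\<lambda>n. W2 (\<nu> n) \<nu>') \<longlonglongrightarrow> 0"
  shows "\<mu>' \<le>\<^sub>s\<^sub>t \<nu>'"
proof (rule st_leI_quantile)
  show dist: "real_distribution \<mu>'" "real_distribution \<nu>'"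
    using P2 by (auto intro: real_distribution_P2)
  note [measurable] = dist[THEN measurable_quantile]
  let ?h = "\<lambda>\<omega>. (max 0 (quantile \<mu>' \<omega> - quantile \<nu>' \<omega>))\<^sup>2"
  have h: "integrable unit_interval ?h"
    by (rule Bochner_Integration.integrable_bound[OF integrable_quantile_diff[OF P2(3,4)]])
      (auto simp: max_def)
  have bound: "(LINT \<omega>|unit_interval. ?h \<omega>) \<le> 2 * (W2 (\<mu> n) \<mu>')\<^sup>2 + 2 * (W2 (\<nu> n) \<nu>')\<^sup>2" for n
  proof -
    let ?a = "\<lambda>\<omega>. quantile (\<mu> n) \<omega> - quantile \<mu>' \<omega>" and ?b = "\<lambda>\<omega>. quantile (\<nu> n) \<omega> - quantile \<nu>' \<omega>"
    note int = integrable_quantile_diff[OF P2(1,3)] integrable_quantile_diff[OF P2(2,4)]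
    have "(LINT \<omega>|unit_interval. ?h \<omega>) \<le> (LINT \<omega>|unit_interval. 2 * (?a \<omega>)\<^sup>2 + 2 * (?b \<omega>)\<^sup>2)"
    proof (rule integral_mono[OF h])
      show "integrable unit_interval (\<lambda>\<omega>. 2 * (?a \<omega>)\<^sup>2 + 2 * (?b \<omega>)\<^sup>2)"
        using int by simp
      fix \<omega> assume "\<omega> \<in> space unit_interval"
      then have "quantile (\<mu> n) \<omega> \<le> quantile (\<nu> n) \<omega>"
        by (intro st_leD_quantile real_distribution_P2 P2 le) (simp add: space_restrict_space)
      \<comment> \<open>\<open>?b \<omega> - ?a \<omega>\<close> is the difference of the limit
        quantiles plus \<open>quantile (\<nu> n) \<omega> - quantile (\<mu> n) \<omega>\<close>,
        which is nonnegative.\<close>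
      then have "?h \<omega> \<le> (?b \<omega> - ?a \<omega>)\<^sup>2"
        by (cases "quantile \<mu>' \<omega> \<le> quantile \<nu>' \<omega>") (auto simp: max_def intro!: power_mono)
      also have "\<dots> \<le> 2 * (?a \<omega>)\<^sup>2 + 2 * (?b \<omega>)\<^sup>2"
        by (rule diff_square_le)
      finally show "?h \<omega> \<le> 2 * (?a \<omega>)\<^sup>2 + 2 * (?b \<omega>)\<^sup>2" .
    qed
    also have "\<dots> = 2 * (W2 (\<mu> n) \<mu>')\<^sup>2 + 2 * (W2 (\<nu> n) \<nu>')\<^sup>2"
      using int by (simp add: W2_eq_quantile P2)
    finally show ?thesis .
  qed
  have "(\<lambda>n. 2 * (W2 (\<mu> n) \<mu>')\<^sup>2 + 2 * (W2 (\<nu> n) \<nu>')\<^sup>2) \<longlonglongrightarrow> 2 * 0\<^sup>2 + 2 * 0\<^sup>2"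
    by (intro tendsto_intros lim)
  then have "(LINT \<omega>|unit_interval. ?h \<omega>) \<le> 0"
    using bound by (intro LIMSEQ_le_const) auto
  then have "(LINT \<omega>|unit_interval. ?h \<omega>) = 0"
    by (intro antisym) auto
  then have "AE \<omega> in unit_interval. ?h \<omega> = 0"
    using integral_nonneg_eq_0_iff_AE[OF h] by simp
  then show "AE \<omega> in unit_interval. quantile \<mu>' \<omega> \<le> quantile \<nu>' \<omega>"
    by eventually_elim (auto simp: max_def split: if_splits)
qed

section \<open>Compactness of order intervals\<close>

text \<open>Weak convergence controls cdfs only away from atoms of the limit. Atoms are countable,
  so a non-atom lies in every interval to the right of \<open>x\<close>.\<close>

lemma (in real_distribution) right_continuity_point:
  assumes f: "continuous (at_right x) f" and less: "f x < (c :: real)"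
  obtains y where "x < y" "f y < c" "measure M {y} = 0"
proof -
  have "eventually (\<lambda>y. f y < c) (at_right x)"
    using f less by (auto simp: continuous_within intro: order_tendstoD)
  then obtain b where b: "b > x" "\<And>y. x < y \<Longrightarrow> y < b \<Longrightarrow> f y < c"
    by (auto simp: eventually_at_right_field)
  obtain y where "y \<in> {x<..<b}" "y \<notin> {x. measure M {x} \<noteq> 0}"
    using open_minus_countable[OF countable_support, of "{x<..<b}"] b(1) by auto
  with b(2) show ?thesis
    by (intro that[of y]) auto
qed

lemma weak_conv_m_tendsto:
  assumes "real_distribution M" "weak_conv_m \<mu> M" "measure M {x} = 0"
  shows "(\<lambda>n. cdf (\<mu> n) x) \<longlonglongrightarrow> cdf M x"
proof -
  interpret real_distribution M by fact
  show ?thesis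
    using assms by (simp add: weak_conv_m_def weak_conv_def isCont_cdf)
qed

text \<open>At non-atoms the bound passes to the limit. A violation at \<open>x\<close> would
  persist at a non-atom \<open>y\<close> slightly to the right, because \<open>cdf l\<close> is
  right continuous and \<open>cdf M\<close> is nondecreasing.\<close>

lemma weak_conv_m_cdf_le:
  assumes M: "real_distribution M" and l: "real_distribution l" and conv: "weak_conv_m \<mu> M"
    and le: "\<And>n x. cdf (\<mu> n) x \<le> cdf l x"
  shows "cdf M x \<le> cdf l x"
proof (rule ccontr)
  interpret M: real_distribution M by fact
  interpret l: real_distribution l by fact
  assume "\<not> cdf M x \<le> cdf l x"
  then obtain y where y: "x < y" "cdf l y < cdf M x" "measure M {y} = 0"
    using M.right_continuity_point[OF l.cdf_is_right_cont, of x "cdf M x"] by auto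
  have "cdf M y \<le> cdf l y"
    using weak_conv_m_tendsto[OF M conv y(3)] le by (intro LIMSEQ_le_const2) auto
  with y M.cdf_nondecreasing[of x y] show False
    by simp
qed

text \<open>Here a violation persists to the right because the limit \<open>cdf M\<close> is right
  continuous and \<open>cdf u\<close> is nondecreasing.\<close>

lemma weak_conv_m_cdf_ge:
  assumes M: "real_distribution M" and u: "real_distribution u" and conv: "weak_conv_m \<mu> M"
    and le: "\<And>n x. cdf u x \<le> cdf (\<mu> n) x"
  shows "cdf u x \<le> cdf M x"
proof (rule ccontr)
  interpret M: real_distribution M by fact
  interpret u: real_distribution u by fact
  assume "\<not> cdf u x \<le> cdf M x"
  then obtain y where y: "x < y" "cdf M y < cdf u x" "measure M {y} = 0"
    using M.right_continuity_point[OF M.cdf_is_right_cont, of x "cdf u x"] by auto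
  have "cdf u y \<le> cdf M y"
    using weak_conv_m_tendsto[OF M conv y(3)] le by (intro LIMSEQ_le_const) auto
  with y u.cdf_nondecreasing[of x y] show False
    by simp
qed

text \<open>The bound \<open>l\<close> controls the mass near minus infinity and \<open>u\<close>
  the mass near plus infinity, uniformly in \<open>n\<close>.\<close>

lemma tight_between:
  assumes \<mu>: "\<And>n. real_distribution (\<mu> n)" and l: "real_distribution l" and u: "real_distribution u"
    and le: "\<And>n x. cdf (\<mu> n) x \<le> cdf l x" "\<And>n x. cdf u x \<le> cdf (\<mu> n) x"
  shows "tight \<mu>"
  unfolding tight_def
proof (intro conjI allI impI \<mu>)
  fix e :: real assume e: "e > 0"
  interpret l: real_distribution l by fact
  interpret u: real_distribution u by fact
  obtain a where a: "cdf l a < e / 2"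
    using order_tendstoD(2)[OF l.cdf_lim_at_bot, of "e / 2"] e eventually_happens'[OF trivial_limit_at_bot_linorder]
    by force
  have "eventually (\<lambda>b. cdf u b > 1 - e / 2 \<and> b > a) at_top"
    using order_tendstoD(1)[OF u.cdf_lim_at_top_prob, of "1 - e / 2"] e eventually_gt_at_top[of a]
    by (intro eventually_conj) auto
  then obtain b where b: "cdf u b > 1 - e / 2" "b > a"
    using eventually_happens'[OF trivial_limit_at_top_linorder] by force
  have "measure (\<mu> n) {a<..b} > 1 - e" for n
  proof -
    interpret \<mu>: real_distribution "\<mu> n" by (rule \<mu>)
    show ?thesis
      using \<mu>.cdf_diff_eq[OF b(2)] le(1)[of n a] le(2)[of b n] a b(1) by simp
  qed
  with b(2) show "\<exists>a b. a < b \<and> (\<forall>n. measure (\<mu> n) {a<..b} > 1 - e)"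
    by blast
qed

text \<open>This supplies the majorant for dominated convergence: each summand is at most
  \<open>ennreal (cdf l s - cdf u t)\<close>.\<close>

lemma monotone_cost_between:
  assumes "\<And>x. cdf \<mu> x \<le> cdf l x" "\<And>x. cdf u x \<le> cdf \<mu> x"
    and "\<And>x. cdf \<nu> x \<le> cdf l x" "\<And>x. cdf u x \<le> cdf \<nu> x"
  shows "monotone_cost \<mu> \<nu> p \<le> 2 * monotone_cost l u p"
proof (cases p)
  case (Pair s t)
  have "ennreal (cdf \<mu> s - cdf \<nu> t) + ennreal (cdf \<nu> s - cdf \<mu> t) \<le>
      2 * ennreal (cdf l s - cdf u t)"
    unfolding mult_2 by (intro add_mono ennreal_leI diff_mono assms)
  also have "\<dots> \<le> 2 * (ennreal (cdf l s - cdf u t) + ennreal (cdf u s - cdf l t))"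
    by (intro mult_left_mono) auto
  finally show ?thesis
    by (simp add: Pair monotone_cost_def)
qed

lemma AE_lborel_pair_countable:
  fixes N :: "real set"
  assumes N: "countable N"
  shows "AE p in lborel \<Otimes>\<^sub>M lborel. fst p \<notin> N \<and> snd p \<notin> N"
proof (rule lborel_pair.AE_pair_measure)
  have [measurable]: "N \<in> sets borel"
    using N by (rule sets.countable[rotated]) simp
  show "{p \<in> space (lborel \<Otimes>\<^sub>M lborel). fst p \<notin> N \<and> snd p \<notin> N} \<in> sets (lborel \<Otimes>\<^sub>M lborel)"
    by measurable
  have "AE x in lborel. x \<notin> N"
    using N by (intro AE_not_in countable_imp_null_set_lborel)
  then show "AE x in lborel. AE y in lborel. fst (x, y) \<notin> N \<and> snd (x, y) \<notin> N"
    by (auto elim!: AE_mp)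
qed

text \<open>Helly's theorem only yields a weakly convergent subsequence. The bounds \<open>l\<close>
  and \<open>u\<close> prevent loss of second moments and upgrade weak convergence to convergence in
  \<open>W2\<close>.\<close>

lemma compactin_st_interval:
  assumes lu: "l \<in> P2" "u \<in> P2"
  shows "compactin W2_topology (st_interval l u)"
  unfolding W2.compactin_sequentially
proof (intro conjI allI impI)
  show "st_interval l u \<subseteq> P2"
    by (auto simp: st_interval_def)
  fix \<mu> :: "nat \<Rightarrow> real measure"
  assume "range \<mu> \<subseteq> st_interval l u"
  then have P2: "\<mu> n \<in> P2" and le: "l \<le>\<^sub>s\<^sub>t \<mu> n" "\<mu> n \<le>\<^sub>s\<^sub>t u" for n
    by (auto simp: st_interval_def)
  note dist = lu[THEN real_distribution_P2] P2[THEN real_distribution_P2]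
  note cdf_le = st_leD_cdf[OF dist(1,3) le(1)] st_leD_cdf[OF dist(3,2) le(2)]
  have "tight \<mu>"
    using dist cdf_le by (intro tight_between[of \<mu> l u]) auto
  from tight_imp_convergent_subsubsequence[OF this strict_mono_id]
  obtain r M where r: "strict_mono r" and M: "real_distribution M" and conv: "weak_conv_m (\<mu> \<circ> r) M"
    by auto
  interpret M: real_distribution M by fact
  have M_le: "cdf M x \<le> cdf l x" "cdf u x \<le> cdf M x" for x
    using weak_conv_m_cdf_le[OF M dist(1) conv] weak_conv_m_cdf_ge[OF M dist(2) conv] cdf_le by auto
  have Q: "quantile l \<omega> \<le> quantile M \<omega>" "quantile M \<omega> \<le> quantile u \<omega>" if "\<omega> \<in> space unit_interval" for \<omega>
    using that M_le by (auto simp: space_restrict_space intro!: quantile_le_quantile dist M)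
  have "M \<in> P2"
    unfolding P2_iff_integrable_quantile[OF M]
  proof (rule Bochner_Integration.integrable_bound)
    show "integrable unit_interval (\<lambda>\<omega>. (quantile l \<omega>)\<^sup>2 + (quantile u \<omega>)\<^sup>2)"
      using lu by (simp add: integrable_quantile_square)
    show "(\<lambda>\<omega>. (quantile M \<omega>)\<^sup>2) \<in> borel_measurable unit_interval"
      using measurable_quantile[OF M] by simp
    have "b\<^sup>2 \<le> a\<^sup>2 + c\<^sup>2" if "a \<le> b" "b \<le> c" for a b c :: real
      using that by (cases "b \<ge> 0")
        (auto intro: add_increasing add_increasing2 simp: abs_le_square_iff[symmetric])
    then show "AE \<omega> in unit_interval. norm ((quantile M \<omega>)\<^sup>2) \<le> norm ((quantile l \<omega>)\<^sup>2 + (quantile u \<omega>)\<^sup>2)"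
      using Q by (intro AE_I2) auto
  qed
  moreover have "l \<le>\<^sub>s\<^sub>t M" "M \<le>\<^sub>s\<^sub>t u"
    using Q by (auto intro!: st_leI_quantile dist M)
  ultimately have M_in: "M \<in> st_interval l u"
    by (simp add: st_interval_def)
  have "(\<lambda>n. \<integral>\<^sup>+p. monotone_cost ((\<mu> \<circ> r) n) M p \<partial>(lborel \<Otimes>\<^sub>M lborel)) \<longlonglongrightarrow>
      (\<integral>\<^sup>+p. (0 :: ennreal) \<partial>(lborel \<Otimes>\<^sub>M lborel :: (real \<times> real) measure))"
  proof (rule nn_integral_dominated_convergence)
    show "monotone_cost ((\<mu> \<circ> r) n) M \<in> borel_measurable (lborel \<Otimes>\<^sub>M lborel)" for n
      using measurable_monotone_cost[OF dist(3) M] by simp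
    show "(\<lambda>p. 2 * monotone_cost l u p) \<in> borel_measurable (lborel \<Otimes>\<^sub>M lborel)"
      using measurable_monotone_cost[OF dist(1,2)] by simp
    show "AE p in lborel \<Otimes>\<^sub>M lborel. monotone_cost ((\<mu> \<circ> r) n) M p \<le> 2 * monotone_cost l u p" for n
      using cdf_le M_le by (intro AE_I2 monotone_cost_between) auto
    \<comment> \<open>Twice the integral is the squared L^2 distance of the quantile functions of
      \<open>l\<close> and \<open>u\<close>, which is finite.\<close>
    have "2 * (\<integral>\<^sup>+p. monotone_cost l u p \<partial>(lborel \<Otimes>\<^sub>M lborel)) < \<infinity>"
      unfolding nn_integral_quantile[OF dist(1,2), symmetric]
        nn_integral_eq_integral[OF integrable_quantile_diff[OF lu], simplified]
      by simp
    then show "(\<integral>\<^sup>+p. 2 * monotone_cost l u p \<partial>(lborel \<Otimes>\<^sub>M lborel)) < \<infinity>"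
      using measurable_monotone_cost[OF dist(1,2)] by (simp add: nn_integral_cmult)
    show "AE p in lborel \<Otimes>\<^sub>M lborel. (\<lambda>n. monotone_cost ((\<mu> \<circ> r) n) M p) \<longlonglongrightarrow> 0"
      using AE_lborel_pair_countable[OF M.countable_support]
    proof eventually_elim
      case (elim p)
      obtain s t where p: "p = (s, t)"
        by (cases p)
      have conv_s: "(\<lambda>n. cdf ((\<mu> \<circ> r) n) s) \<longlonglongrightarrow> cdf M s" and conv_t: "(\<lambda>n. cdf ((\<mu> \<circ> r) n) t) \<longlonglongrightarrow> cdf M t"
        using elim weak_conv_m_tendsto[OF M conv, of s] weak_conv_m_tendsto[OF M conv, of t]
        by (simp_all add: p)
      \<comment> \<open>Off the atoms of \<open>M\<close> both summands of the cost converge to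
        \<open>ennreal (cdf M s - cdf M t)\<close>, and for \<open>s \<le> t\<close> this truncates
        to 0.\<close>
      have "(\<lambda>n. ennreal (cdf ((\<mu> \<circ> r) n) s - cdf M t) + ennreal (cdf M s - cdf ((\<mu> \<circ> r) n) t)) \<longlonglongrightarrow>
          ennreal (cdf M s - cdf M t) + ennreal (cdf M s - cdf M t)"
        by (intro tendsto_intros conv_s conv_t)
      then show ?case
        using M.cdf_nondecreasing[of s t] by (cases "s \<le> t") (simp_all add: p monotone_cost_def ennreal_neg)
    qed
  qed simp
  then have "(\<lambda>n. 2 * (\<integral>\<^sup>+p. monotone_cost ((\<mu> \<circ> r) n) M p \<partial>(lborel \<Otimes>\<^sub>M lborel))) \<longlonglongrightarrow> 2 * 0"
    by (intro ennreal_tendsto_cmult) auto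
  then have "(\<lambda>n. enn2real (2 * (\<integral>\<^sup>+p. monotone_cost ((\<mu> \<circ> r) n) M p \<partial>(lborel \<Otimes>\<^sub>M lborel)))) \<longlonglongrightarrow> 0"
    by (intro tendsto_enn2real) auto
  then have "(\<lambda>n. W2 ((\<mu> \<circ> r) n) M) \<longlonglongrightarrow> 0"
    using tendsto_real_sqrt[where x = 0] by (simp add: W2_eq_monotone_cost dist M)
  with P2 \<open>M \<in> P2\<close> have "limitin W2_topology (\<mu> \<circ> r) M sequentially"
    by (simp add: W2.limitin_metric_dist_null)
  with M_in r show "\<exists>M r. M \<in> st_interval l u \<and> strict_mono r \<and> limitin W2_topology (\<mu> \<circ> r) M sequentially"
    by blast
qed

lemma compactin_order_bounded:
  assumes "order_bounded K" "closedin W2_topology K"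
  shows "compactin W2_topology K"
proof -
  obtain u l where "u \<in> P2" "\<And>\<mu>. \<mu> \<in> K \<Longrightarrow> \<mu> \<le>\<^sub>s\<^sub>t u" "l \<in> P2" "\<And>\<mu>. \<mu> \<in> K \<Longrightarrow> l \<le>\<^sub>s\<^sub>t \<mu>"
    using assms(1) unfolding order_bounded_def by blast
  moreover have "K \<subseteq> P2"
    using closedin_subset[OF assms(2)] by simp
  ultimately have "K \<subseteq> st_interval l u"
    by (auto simp: st_interval_def)
  then show ?thesis
    using closed_compactin[OF compactin_st_interval[OF \<open>l \<in> P2\<close> \<open>u \<in> P2\<close>] _ assms(2)] by simp
qed

section \<open>Limit sets of semiflows\<close>

text \<open>Trades the extended-real supremum and infimum for a uniform epsilon statement, the form
  that later arguments unfold.\<close>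

lemma attracts_iff:
  "attracts P A B \<longleftrightarrow> (\<forall>e>0. \<forall>\<^sub>F t in at_top. \<forall>b\<in>B. \<exists>a\<in>A. W2 (P t b) a < e)"
proof
  assume *: "attracts P A B"
  show "\<forall>e>0. \<forall>\<^sub>F t in at_top. \<forall>b\<in>B. \<exists>a\<in>A. W2 (P t b) a < e"
  proof (intro allI impI)
    fix e :: real assume e: "e > 0"
    then have "\<forall>\<^sub>F t in at_top. W2_set (P t ` B) A < ennreal e"
      using * by (auto simp: attracts_def intro: order_tendstoD)
    then show "\<forall>\<^sub>F t in at_top. \<forall>b\<in>B. \<exists>a\<in>A. W2 (P t b) a < e"
    proof eventually_elim
      case (elim t)
      show ?case
      proof
        fix b assume "b \<in> B"
        then have "(INF a\<in>A. ennreal (W2 (P t b) a)) < ennreal e"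
          using elim unfolding W2_set_def by (rule_tac SUP_lessD) auto
        then show "\<exists>a\<in>A. W2 (P t b) a < e"
          by (auto simp: INF_less_iff ennreal_less_iff)
      qed
    qed
  qed
next
  assume *: "\<forall>e>0. \<forall>\<^sub>F t in at_top. \<forall>b\<in>B. \<exists>a\<in>A. W2 (P t b) a < e"
  show "attracts P A B"
    unfolding attracts_def
  proof (rule order_tendstoI)
    fix c :: ennreal assume "0 < c"
    \<comment> \<open>A supremum turns the strict bound \<open>e\<close> into a weak one, so
      \<open>e\<close> is taken strictly below \<open>c\<close>.\<close>
    then obtain d where d: "0 < d" "d < c"
      using dense by blast
    then obtain e where e: "d = ennreal e" "0 < e"
      by (cases d) auto
    show "\<forall>\<^sub>F t in at_top. W2_set (P t ` B) A < c"
      using *[rule_format, OF e(2)]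
    proof eventually_elim
      case (elim t)
      have "W2_set (P t ` B) A \<le> ennreal e"
        unfolding W2_set_def
      proof (rule SUP_least)
        fix \<mu> assume "\<mu> \<in> P t ` B"
        then obtain a where "a \<in> A" "W2 \<mu> a < e"
          using elim by auto
        then show "(INF a\<in>A. ennreal (W2 \<mu> a)) \<le> ennreal e"
          by (intro INF_lower2[of a]) (auto intro: ennreal_leI)
      qed
      with d e show ?case
        by simp
    qed
  qed simp
qed

lemma attracts_mono: "attracts P A B \<Longrightarrow> A \<subseteq> A' \<Longrightarrow> B' \<subseteq> B \<Longrightarrow> attracts P A' B'"
  unfolding attracts_iff by (elim all_forward imp_forward eventually_mono) blast+

lemma attracts_singleton: "attracts P {\<nu>} {\<rho>} \<longleftrightarrow> ((\<lambda>t. W2 (P t \<rho>) \<nu>) \<longlongrightarrow> 0) at_top"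
  by (simp add: attracts_iff tendsto_iff)

text \<open>Membership of \<open>P t b\<close> in \<open>P2\<close> is explicit since
  \<open>B\<close> is arbitrary here and the metric closure sees only points of
  \<open>P2\<close>.\<close>

lemma in_omega_limit_iff:
  "x \<in> omega_limit P B \<longleftrightarrow>
    x \<in> P2 \<and> (\<forall>s\<ge>0. \<forall>e>0. \<exists>t\<ge>s. \<exists>b\<in>B. P t b \<in> P2 \<and> W2 x (P t b) < e)"
proof -
  have *: "(\<exists>y\<in>\<Union>t\<in>{s..}. P t ` B. y \<in> W2.mball x e) \<longleftrightarrow>
      x \<in> P2 \<and> (\<exists>t\<ge>s. \<exists>b\<in>B. P t b \<in> P2 \<and> W2 x (P t b) < e)" for s e
    unfolding W2.in_mball by blast
  show ?thesis
    unfolding omega_limit_def W2.metric_closure_of INT_iff mem_Collect_eq * atLeast_iff Ball_def by blast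
qed

lemma omega_limitE:
  assumes "x \<in> omega_limit P B"
  obtains t b where "\<And>n. t n \<ge> real n" "\<And>n. b n \<in> B"
    "limitin W2_topology (\<lambda>n. P (t n) (b n)) x sequentially"
proof -
  have "\<exists>t b. real n \<le> t \<and> b \<in> B \<and> P t b \<in> P2 \<and> W2 x (P t b) < inverse (real (Suc n))" for n
    using assms unfolding in_omega_limit_iff
    by (metis inverse_positive_iff_positive of_nat_0_le_iff of_nat_0_less_iff zero_less_Suc)
  then obtain t b where tb: "\<And>n. t n \<ge> real n" "\<And>n. b n \<in> B" "\<And>n. P (t n) (b n) \<in> P2"
    "\<And>n. W2 x (P (t n) (b n)) < inverse (real (Suc n))"
    by metis
  have "(\<lambda>n. W2 (P (t n) (b n)) x) \<longlonglongrightarrow> 0"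
    by (rule tendsto_sandwich[OF _ _ tendsto_const LIMSEQ_inverse_real_of_nat])
      (use tb(4) in \<open>auto simp: W2.commute[of _ x] intro!: always_eventually less_imp_le\<close>)
  with assms tb show ?thesis
    by (intro that[of t b]) (auto simp: W2.limitin_metric_dist_null in_omega_limit_iff)
qed

lemma omega_limitI:
  assumes t: "filterlim t at_top sequentially" and b: "\<And>n. b n \<in> B"
    and lim: "limitin W2_topology (\<lambda>n. P (t n) (b n)) x sequentially"
  shows "x \<in> omega_limit P B"
  unfolding in_omega_limit_iff
proof (intro conjI allI impI)
  show "x \<in> P2"
    using lim by (simp add: W2.limitin_metric_dist_null)
  fix s e :: real assume "s \<ge> 0" "e > 0"
  then have "\<forall>\<^sub>F n in sequentially. P (t n) (b n) \<in> P2 \<and> W2 (P (t n) (b n)) x < e \<and> s \<le> t n"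
    using lim t by (auto simp: W2.limitin_metric filterlim_at_top eventually_conj_iff)
  then obtain n where "P (t n) (b n) \<in> P2 \<and> W2 (P (t n) (b n)) x < e \<and> s \<le> t n"
    using eventually_happens'[OF sequentially_bot] by blast
  then show "\<exists>t\<ge>s. \<exists>b\<in>B. P t b \<in> P2 \<and> W2 x (P t b) < e"
    using b by (metis W2.commute)
qed

lemma closedin_omega_limit: "closedin W2_topology (omega_limit P B)"
  unfolding omega_limit_def by (intro closedin_INT) auto

section \<open>Compactness, attraction and invariance of limit sets\<close>

locale wasserstein_semiflow =
  fixes P :: "real \<Rightarrow> real measure \<Rightarrow> real measure"
  assumes semiflow: "semiflow P"
begin

lemma flow_0: "\<mu> \<in> P2 \<Longrightarrow> P 0 \<mu> = \<mu>"
  using semiflow by (simp add: semiflow_def)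

lemma flow_add: "\<mu> \<in> P2 \<Longrightarrow> 0 \<le> t \<Longrightarrow> 0 \<le> s \<Longrightarrow> P t (P s \<mu>) = P (t + s) \<mu>"
  using semiflow by (simp add: semiflow_def)

lemma continuous_map_flow:
  assumes "0 \<le> t"
  shows "continuous_map W2_topology W2_topology (P t)"
proof -
  have "continuous_map W2_topology (prod_topology (top_of_set {0..}) W2_topology) (\<lambda>\<mu>. (t, \<mu>))"
    using assms by (intro continuous_map_pairedI) auto
  from continuous_map_compose[OF this] semiflow show ?thesis
    by (fastforce simp: semiflow_def comp_def)
qed

lemma flow_in_P2: "0 \<le> t \<Longrightarrow> \<mu> \<in> P2 \<Longrightarrow> P t \<mu> \<in> P2"
  using continuous_map_image_subset_topspace[OF continuous_map_flow, of t] by auto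

lemma flow_limit:
  assumes "0 \<le> t" "limitin W2_topology \<mu> \<nu> F"
  shows "limitin W2_topology (\<lambda>n. P t (\<mu> n)) (P t \<nu>) F"
  using continuous_map_limit[OF continuous_map_flow[OF assms(1)] assms(2)] by (simp add: comp_def)

end

text \<open>One setting covers the limit set of \<open>K\<close> itself, of a bounded set and of a
  single orbit, each attracted by a compact set.\<close>

locale attracted_set = wasserstein_semiflow +
  fixes K B :: "real measure set"
  assumes compact: "compactin W2_topology K"
    and B_P2: "B \<subseteq> P2"
    and attr: "attracts P K B"
begin

text \<open>Asymptotic compactness: orbit points are approximated by points \<open>a k\<close> of
  \<open>K\<close>, and a convergent subsequence of these drags the orbit points along.\<close>

lemma attracted_subsequence:
  assumes t: "filterlim t at_top sequentially" "\<And>n. 0 \<le> t n" and b: "\<And>n. b n \<in> B"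
  obtains x r where "x \<in> K" "strict_mono r"
    "limitin W2_topology (\<lambda>n. P (t (r n)) (b (r n))) x sequentially"
proof -
  have K: "K \<subseteq> P2"
    using compactin_subset_topspace[OF compact] by simp
  have "\<forall>\<^sub>F n in sequentially. \<exists>a\<in>K. W2 (P (t n) (b n)) a < inverse (real (Suc k))" for k
  proof -
    have "\<forall>\<^sub>F t in at_top. \<forall>b\<in>B. \<exists>a\<in>K. W2 (P t b) a < inverse (real (Suc k))"
      using attr unfolding attracts_iff by simp
    then have "\<forall>\<^sub>F n in sequentially. \<forall>b\<in>B. \<exists>a\<in>K. W2 (P (t n) b) a < inverse (real (Suc k))"
      using t(1) by (rule eventually_compose_filterlim)
    then show ?thesis
      by (rule eventually_mono) (simp add: b)
  qed
  then have "\<exists>N. \<forall>n\<ge>N. \<exists>a\<in>K. W2 (P (t n) (b n)) a < inverse (real (Suc k))" for k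
    by (simp add: eventually_sequentially)
  then obtain N where N: "\<And>k n. n \<ge> N k \<Longrightarrow> \<exists>a\<in>K. W2 (P (t n) (b n)) a < inverse (real (Suc k))"
    by metis
  \<comment> \<open>Adding up the thresholds makes \<open>q\<close> strictly increasing with
    \<open>q k \<ge> N k\<close>, so the error at index \<open>q k\<close> is below
    \<open>1/(k+1)\<close>.\<close>
  define q where "q k = k + (\<Sum>i\<le>k. N i)" for k
  have q: "strict_mono q" "q k \<ge> N k" for k
    by (auto simp: q_def strict_mono_Suc_iff intro: trans_le_add2 member_le_sum)
  obtain a where a: "\<And>k. a k \<in> K" "\<And>k. W2 (P (t (q k)) (b (q k))) (a k) < inverse (real (Suc k))"
    using N[OF q(2)] by metis
  obtain x r where x: "x \<in> K" "strict_mono r" "limitin W2_topology (a \<circ> r) x sequentially"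
    using compact[unfolded W2.compactin_sequentially] a(1) by blast
  have PP: "P (t n) (b n) \<in> P2" for n
    using t b B_P2 by (intro flow_in_P2) auto
  have lim: "(\<lambda>n. inverse (real (Suc (r n))) + W2 (a (r n)) x) \<longlonglongrightarrow> 0 + 0"
    using x(3) by (intro tendsto_add LIMSEQ_subseq_LIMSEQ[OF LIMSEQ_inverse_real_of_nat x(2), unfolded comp_def])
      (simp add: W2.limitin_metric_dist_null)
  have bound: "W2 (P (t (q (r n))) (b (q (r n)))) x \<le> inverse (real (Suc (r n))) + W2 (a (r n)) x" for n
    using W2.triangle[OF PP, of "a (r n)" x "q (r n)"] a[of "r n"] x(1) K by fastforce
  have "(\<lambda>n. W2 (P (t (q (r n))) (b (q (r n)))) x) \<longlonglongrightarrow> 0"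
    by (rule tendsto_sandwich[OF _ _ tendsto_const lim[simplified]]) (use bound in auto)
  then have "limitin W2_topology (\<lambda>n. P (t ((q \<circ> r) n)) (b ((q \<circ> r) n))) x sequentially"
    using PP x(1) K by (auto simp: W2.limitin_metric_dist_null)
  with x(1) show ?thesis
    using strict_mono_o[OF q(1) x(2)] by (intro that[of x "q \<circ> r"])
qed

lemma omega_limit_subset: "omega_limit P B \<subseteq> K"
proof
  fix x assume "x \<in> omega_limit P B"
  then obtain t b where t: "\<And>n. t n \<ge> real n" and b: "\<And>n. b n \<in> B"
    and lim: "limitin W2_topology (\<lambda>n. P (t n) (b n)) x sequentially"
    by (rule omega_limitE) blast
  have "filterlim t at_top sequentially"
    by (rule filterlim_at_top_mono[OF filterlim_real_sequentially]) (simp add: t)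
  moreover have "0 \<le> t n" for n
    using t[of n] by linarith
  ultimately obtain y r where y: "y \<in> K" "strict_mono r"
    "limitin W2_topology (\<lambda>n. P (t (r n)) (b (r n))) y sequentially"
    using b by (rule attracted_subsequence)
  have "x = y"
    using limitin_subsequence[OF y(2) lim] y(3)
    by (intro W2.limitin_metric_unique[of "\<lambda>n. P (t (r n)) (b (r n))" _ sequentially]) (auto simp: comp_def)
  with y show "x \<in> K"
    by simp
qed

lemma attracted_subsequence_omega_limit:
  assumes t: "filterlim t at_top sequentially" "\<And>n. 0 \<le> t n" and b: "\<And>n. b n \<in> B"
  obtains x r where "x \<in> omega_limit P B" "strict_mono r"
    "limitin W2_topology (\<lambda>n. P (t (r n)) (b (r n))) x sequentially"
proof -
  obtain x r where x: "x \<in> K" "strict_mono r"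
    "limitin W2_topology (\<lambda>n. P (t (r n)) (b (r n))) x sequentially"
    using assms by (rule attracted_subsequence)
  have "filterlim (\<lambda>n. t (r n)) at_top sequentially"
    using filterlim_compose[OF t(1) filterlim_subseq[OF x(2)]] .
  then have "x \<in> omega_limit P B"
    using x(3) b by (intro omega_limitI[of "\<lambda>n. t (r n)" "\<lambda>n. b (r n)"])
  with x(2,3) show ?thesis
    by (intro that)
qed

lemma compactin_omega_limit: "compactin W2_topology (omega_limit P B)"
  by (rule closed_compactin[OF compact omega_limit_subset closedin_omega_limit])

text \<open>Otherwise points outside \<open>U\<close> at arbitrarily late times would accumulate at
  a point of the limit set, of which \<open>U\<close> is an open neighbourhood.\<close>

lemma eventually_flow_in_open:
  assumes U: "openin W2_topology U" "omega_limit P B \<subseteq> U"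
  shows "\<forall>\<^sub>F t in at_top. P t ` B \<subseteq> U"
proof (rule ccontr)
  assume "\<not> (\<forall>\<^sub>F t in at_top. P t ` B \<subseteq> U)"
  then have "\<exists>t b. t \<ge> real n \<and> b \<in> B \<and> P t b \<notin> U" for n
    by (auto simp: eventually_at_top_linorder) (meson image_subset_iff)
  then obtain t b where t: "\<And>n. t n \<ge> real n" and b: "\<And>n. b n \<in> B" and out: "\<And>n. P (t n) (b n) \<notin> U"
    by metis
  have "filterlim t at_top sequentially"
    by (rule filterlim_at_top_mono[OF filterlim_real_sequentially]) (simp add: t)
  moreover have "0 \<le> t n" for n
    using t[of n] by linarith
  ultimately obtain x r where "x \<in> omega_limit P B"
    "limitin W2_topology (\<lambda>n. P (t (r n)) (b (r n))) x sequentially"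
    using b by (rule attracted_subsequence_omega_limit)
  with U have "\<forall>\<^sub>F n in sequentially. P (t (r n)) (b (r n)) \<in> U"
    by (auto simp: limitin_def)
  with out show False
    by simp
qed

lemma omega_limit_attracts: "attracts P (omega_limit P B) B"
  unfolding attracts_iff
proof (intro allI impI)
  fix e :: real assume e: "e > 0"
  have "openin W2_topology (\<Union>x\<in>omega_limit P B. W2.mball x e)"
    by (intro openin_Union) auto
  moreover have "omega_limit P B \<subseteq> (\<Union>x\<in>omega_limit P B. W2.mball x e)"
    using e by (auto simp: in_omega_limit_iff)
  ultimately have "\<forall>\<^sub>F t in at_top. P t ` B \<subseteq> (\<Union>x\<in>omega_limit P B. W2.mball x e)"
    by (rule eventually_flow_in_open)
  then show "\<forall>\<^sub>F t in at_top. \<forall>b\<in>B. \<exists>a\<in>omega_limit P B. W2 (P t b) a < e"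
    by eventually_elim (force simp: image_subset_iff W2.commute)
qed

lemma omega_limit_nonempty: "B \<noteq> {} \<Longrightarrow> omega_limit P B \<noteq> {}"
proof
  assume "B \<noteq> {}" "omega_limit P B = {}"
  then have "\<forall>\<^sub>F t in at_top :: real filter. False"
    using omega_limit_attracts by (auto simp: attracts_iff dest!: spec[of _ 1])
  then show False
    by simp
qed

text \<open>Continuity of \<open>P s\<close> moves limit points forward. For a preimage, the times
  are shifted back by \<open>s\<close>, and compactness supplies a limit point of the shifted
  sequence.\<close>

lemma invariant_omega_limit: "invariant_set P (omega_limit P B)"
  unfolding invariant_set_def
proof (intro conjI allI impI equalityI subsetI)
  show "x \<in> P2" if "x \<in> omega_limit P B" for x
    using that by (simp add: in_omega_limit_iff)
  fix s :: real and y assume s: "0 \<le> s"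
  {
    assume "y \<in> P s ` omega_limit P B"
    then obtain x where y: "y = P s x" and x: "x \<in> omega_limit P B"
      by auto
    from x obtain t b where t: "\<And>n. t n \<ge> real n" and b: "\<And>n. b n \<in> B"
      and lim: "limitin W2_topology (\<lambda>n. P (t n) (b n)) x sequentially"
      by (rule omega_limitE) blast
    have t0: "0 \<le> t n" for n
      using t[of n] by linarith
    have "P s (P (t n) (b n)) = P (s + t n) (b n)" for n
      using b B_P2 s t0 by (intro flow_add) auto
    then have "limitin W2_topology (\<lambda>n. P (s + t n) (b n)) y sequentially"
      using flow_limit[OF s lim] y by simp
    moreover have "filterlim (\<lambda>n. s + t n) at_top sequentially"
      by (rule filterlim_at_top_mono[OF filterlim_real_sequentially]) (use t s in \<open>simp add: add_increasing\<close>)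
    ultimately show "y \<in> omega_limit P B"
      using b by (intro omega_limitI[of "\<lambda>n. s + t n" b])
  }
  {
    assume "y \<in> omega_limit P B"
    then obtain t b where t: "\<And>n. t n \<ge> real n" and b: "\<And>n. b n \<in> B"
      and lim: "limitin W2_topology (\<lambda>n. P (t n) (b n)) y sequentially"
      by (rule omega_limitE) blast
    \<comment> \<open>Truncation at 0 keeps every time admissible; \<open>s + t' n = t n\<close>
      holds once \<open>t n \<ge> s\<close>, hence for all large \<open>n\<close>.\<close>
    define t' where "t' n = max 0 (t n - s)" for n
    have lim_t': "filterlim t' at_top sequentially"
    proof (rule filterlim_at_top_mono)
      show "filterlim (\<lambda>n. real n - s) at_top sequentially"
        using filterlim_tendsto_add_at_top[OF tendsto_const[of "- s"] filterlim_real_sequentially] by simp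
      show "\<forall>\<^sub>F n in sequentially. real n - s \<le> t' n"
        using t by (intro always_eventually) (simp add: t'_def le_max_iff_disj)
    qed
    moreover have t'0: "0 \<le> t' n" for n
      by (simp add: t'_def)
    ultimately obtain x r where x: "x \<in> omega_limit P B" "strict_mono r"
      "limitin W2_topology (\<lambda>n. P (t' (r n)) (b (r n))) x sequentially"
      using b by (rule attracted_subsequence_omega_limit)
    have "\<forall>\<^sub>F n in sequentially. real n \<ge> s"
      using filterlim_real_sequentially by (simp add: filterlim_at_top)
    then have "\<forall>\<^sub>F n in sequentially. P s (P (t' (r n)) (b (r n))) = P (t (r n)) (b (r n))"
    proof eventually_elim
      case (elim n)
      have "s \<le> t (r n)"
        using elim t[of "r n"] seq_suble[OF x(2), of n] by simp
      then show ?case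
        using flow_add[of "b (r n)" s "t' (r n)"] b B_P2 s t'0 by (auto simp: t'_def)
    qed
    with flow_limit[OF s x(3)] have "limitin W2_topology (\<lambda>n. P (t (r n)) (b (r n))) (P s x) sequentially"
      by (rule limitin_transform_eventually[rotated])
    then have "y = P s x"
      using limitin_subsequence[OF x(2) lim]
      by (intro W2.limitin_metric_unique[of "\<lambda>n. P (t (r n)) (b (r n))" _ sequentially]) (auto simp: comp_def)
    with x(1) show "y \<in> P s ` omega_limit P B"
      by blast
  }
qed

end

section \<open>The global attractor and its connectedness\<close>

locale global_attracting_set = wasserstein_semiflow +
  fixes K :: "real measure set"
  assumes compact: "compactin W2_topology K"
    and eventually_invariant: "eventually_positively_invariant P K"
    and attr: "\<And>B. W2_bounded B \<Longrightarrow> attracts P K B"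
begin

lemma K_P2: "K \<subseteq> P2"
  using eventually_invariant by (simp add: eventually_positively_invariant_def)

lemma attracted_set: "W2_bounded B \<Longrightarrow> attracted_set P K B"
  using compact attr W2.mbounded_subset_mspace by unfold_locales auto

text \<open>A compact set is bounded, so \<open>K\<close> attracts itself.\<close>

sublocale self: attracted_set P K K
  using compact by (intro attracted_set W2.compactin_imp_mbounded)

lemma omega_limit_P2: "omega_limit P K \<subseteq> P2"
  using self.omega_limit_subset K_P2 by blast

lemma flow_omega_limit: "0 \<le> t \<Longrightarrow> P t ` omega_limit P K = omega_limit P K"
  using self.invariant_omega_limit by (simp add: invariant_set_def)

lemma omega_limit_subset_image: "0 \<le> t \<Longrightarrow> omega_limit P K \<subseteq> P t ` K"
  using flow_omega_limit self.omega_limit_subset by blast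

text \<open>A point in all images of \<open>K\<close> is its own approximation at every late time,
  at distance 0. The other inclusion combines invariance of the limit set with its inclusion in
  \<open>K\<close>.\<close>

lemma omega_limit_eq_INT: "omega_limit P K = (\<Inter>t\<in>{0..}. P t ` K)"
proof
  show "omega_limit P K \<subseteq> (\<Inter>t\<in>{0..}. P t ` K)"
    using omega_limit_subset_image by auto
  show "(\<Inter>t\<in>{0..}. P t ` K) \<subseteq> omega_limit P K"
  proof
    fix x assume x: "x \<in> (\<Inter>t\<in>{0..}. P t ` K)"
    then have "x \<in> P 0 ` K"
      by simp
    then have "x \<in> P2"
      using flow_0 K_P2 by auto
    moreover have "\<exists>b\<in>K. P s b = x" if "0 \<le> s" for s
      using x that by auto
    ultimately show "x \<in> omega_limit P K"
      unfolding in_omega_limit_iff by (metis W2.zero order_refl)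
  qed
qed

text \<open>An invariant subset of \<open>K\<close> lies in every image of \<open>K\<close> under
  the flow, hence in their intersection.\<close>

lemma omega_limit_subset_omega_limit:
  assumes "W2_bounded B"
  shows "omega_limit P B \<subseteq> omega_limit P K"
proof -
  interpret attracted_set P K B
    by (rule attracted_set) fact
  have "omega_limit P B = P t ` omega_limit P B" if "0 \<le> t" for t
    using invariant_omega_limit that by (simp add: invariant_set_def)
  then have "omega_limit P B \<subseteq> P t ` K" if "0 \<le> t" for t
    using that omega_limit_subset by blast
  then show ?thesis
    unfolding omega_limit_eq_INT by auto
qed

lemma global_attractor_omega_limit: "global_attractor P (omega_limit P K)"
  unfolding global_attractor_def
proof (intro conjI allI impI)
  fix B assume B: "W2_bounded B"
  then interpret attracted_set P K B
    by (rule attracted_set)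
  show "attracts P (omega_limit P K) B"
    using omega_limit_attracts omega_limit_subset_omega_limit[OF B] by (rule attracts_mono) simp
qed (rule self.compactin_omega_limit self.invariant_omega_limit)+

text \<open>A separation of the limit set thickens to disjoint open sets whose union contains the
  image of \<open>K\<close> at some late time. That image is connected and meets both, a
  contradiction.\<close>

lemma connectedin_omega_limit:
  assumes "connectedin W2_topology K"
  shows "connectedin W2_topology (omega_limit P K)"
proof (rule ccontr)
  let ?O = "omega_limit P K"
  assume "\<not> connectedin W2_topology ?O"
  then obtain E1 E2 where E: "closedin W2_topology E1" "closedin W2_topology E2" "?O \<subseteq> E1 \<union> E2"
    "E1 \<inter> E2 \<inter> ?O = {}" "E1 \<inter> ?O \<noteq> {}" "E2 \<inter> ?O \<noteq> {}"
    using omega_limit_P2 by (auto simp: connectedin_closedin)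
  have "compactin W2_topology (E1 \<inter> ?O)" "compactin W2_topology (E2 \<inter> ?O)"
    using E self.compactin_omega_limit by (auto intro: closed_Int_compactin)
  moreover have "disjnt (E1 \<inter> ?O) (E2 \<inter> ?O)"
    using E by (auto simp: disjnt_def)
  ultimately obtain U V where UV: "openin W2_topology U" "openin W2_topology V" "E1 \<inter> ?O \<subseteq> U"
    "E2 \<inter> ?O \<subseteq> V" "disjnt U V"
    using Hausdorff_space_compact_separation[OF W2.Hausdorff_space_mtopology] by metis
  have "\<forall>\<^sub>F t in at_top. P t ` K \<subseteq> U \<union> V"
    using UV E by (intro self.eventually_flow_in_open openin_Un) auto
  then have "\<forall>\<^sub>F t in at_top. P t ` K \<subseteq> U \<union> V \<and> 0 \<le> t"
    using eventually_ge_at_top by (rule eventually_conj)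
  then obtain t where t: "P t ` K \<subseteq> U \<union> V" "0 \<le> t"
    using eventually_happens'[OF trivial_limit_at_top_linorder] by blast
  have "connectedin W2_topology (P t ` K)"
    using continuous_map_flow[OF t(2)] assms by (rule connectedin_continuous_map_image)
  moreover have "?O \<subseteq> P t ` K"
    using t(2) by (rule omega_limit_subset_image)
  then have "U \<inter> P t ` K \<noteq> {}" "V \<inter> P t ` K \<noteq> {}"
    using UV(3,4) E(5,6) by blast+
  moreover have "U \<inter> V \<inter> P t ` K = {}"
    using UV(5) by (auto simp: disjnt_def)
  ultimately show False
    using UV(1,2) t(1) unfolding connectedin by metis
qed

end

section \<open>Order-preserving semiflows\<close>

text \<open>The relation \<open>R\<close> stands for the stochastic order or its converse, so that each statement
  about \<open>\<nu>hi\<close> also gives the dual one about \<open>\<nu>lo\<close>.\<close>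

locale ordered_attracting_set = global_attracting_set +
  fixes R :: "real measure \<Rightarrow> real measure \<Rightarrow> bool"
  assumes R_limit: "\<And>\<mu> \<nu> \<mu>' \<nu>'. \<lbrakk>\<And>n. \<mu> n \<in> P2; \<And>n. \<nu> n \<in> P2; \<mu>' \<in> P2; \<nu>' \<in> P2; \<And>n. R (\<mu> n) (\<nu> n);
      (\<lambda>n. W2 (\<mu> n) \<mu>') \<longlonglongrightarrow> 0; (\<lambda>n. W2 (\<nu> n) \<nu>') \<longlonglongrightarrow> 0\<rbrakk> \<Longrightarrow> R \<mu>' \<nu>'"
    and R_antisym: "\<And>\<mu> \<nu>. \<lbrakk>\<mu> \<in> P2; \<nu> \<in> P2; R \<mu> \<nu>; R \<nu> \<mu>\<rbrakk> \<Longrightarrow> \<mu> = \<nu>"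
    and R_flow: "\<And>\<mu> \<nu> t. \<lbrakk>\<mu> \<in> P2; \<nu> \<in> P2; R \<mu> \<nu>; 0 \<le> t\<rbrakk> \<Longrightarrow> R (P t \<mu>) (P t \<nu>)"
begin

text \<open>The orbits of \<open>\<sigma>\<close> and \<open>\<rho>\<close> stay ordered at equal
  times, and the closed relation \<open>R\<close> passes to the limit.\<close>

lemma R_omega_limit:
  assumes \<sigma>: "\<sigma> \<in> P2" and \<rho>: "\<rho> \<in> P2" and "R \<sigma> \<rho>" and \<nu>: "\<nu> \<in> P2"
    and lim: "((\<lambda>t. W2 (P t \<sigma>) \<nu>) \<longlongrightarrow> 0) at_top" and x: "x \<in> omega_limit P {\<rho>}"
  shows "R \<nu> x"
proof -
  obtain t b where t: "\<And>n. t n \<ge> real n" and b: "\<And>n. b n \<in> {\<rho>}"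
    and limx: "limitin W2_topology (\<lambda>n. P (t n) (b n)) x sequentially"
    using x by (rule omega_limitE) blast
  have "filterlim t at_top sequentially"
    by (rule filterlim_at_top_mono[OF filterlim_real_sequentially]) (simp add: t)
  then have "(\<lambda>n. W2 (P (t n) \<sigma>) \<nu>) \<longlonglongrightarrow> 0"
    using lim by (rule filterlim_compose[rotated])
  moreover have "0 \<le> t n" for n
    using t[of n] by linarith
  moreover have "b n = \<rho>" for n
    using b by simp
  ultimately show ?thesis
    using limx \<sigma> \<rho> \<nu> \<open>R \<sigma> \<rho>\<close>
    by (rule_tac R_limit[where \<mu> = "\<lambda>n. P (t n) \<sigma>" and \<nu> = "\<lambda>n. P (t n) \<rho>", OF _ _ \<nu> _ R_flow])
      (simp_all add: W2.limitin_metric_dist_null flow_in_P2)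
qed

text \<open>This one comparison gives all later convergence claims for single orbits:
  \<open>\<sigma>\<close> may be \<open>\<nu>\<close> itself, a member of an attracted set, or a
  measure on the other side of \<open>\<nu>\<close>.\<close>

lemma attracts_above:
  assumes \<nu>: "\<nu> \<in> omega_limit P K" "\<And>\<mu>. \<mu> \<in> omega_limit P K \<Longrightarrow> R \<mu> \<nu>"
    and \<sigma>: "\<sigma> \<in> P2" and \<rho>: "\<rho> \<in> P2" and "R \<sigma> \<rho>"
    and lim: "((\<lambda>t. W2 (P t \<sigma>) \<nu>) \<longlongrightarrow> 0) at_top"
  shows "((\<lambda>t. W2 (P t \<rho>) \<nu>) \<longlongrightarrow> 0) at_top"
proof -
  have bounded: "W2_bounded {\<rho>}"
    using \<rho> by (simp add: W2.mbounded_insert)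
  then interpret attracted_set P K "{\<rho>}"
    by (rule attracted_set)
  have "x = \<nu>" if x: "x \<in> omega_limit P {\<rho>}" for x
  proof (rule R_antisym)
    have "x \<in> omega_limit P K"
      using x omega_limit_subset_omega_limit[OF bounded] by blast
    then show "R x \<nu>" "x \<in> P2"
      using \<nu> omega_limit_P2 by auto
    show \<nu>_P2: "\<nu> \<in> P2"
      using \<nu> omega_limit_P2 by auto
    show "R \<nu> x"
      by (rule R_omega_limit[OF \<sigma> \<rho> \<open>R \<sigma> \<rho>\<close> \<nu>_P2 lim x])
  qed
  then have "attracts P {\<nu>} {\<rho>}"
    using omega_limit_attracts by (rule_tac attracts_mono) auto
  then show ?thesis
    by (simp add: attracts_singleton)
qed

lemma extremal_invariant_measure:
  assumes u: "u \<in> P2" "\<And>\<mu>. \<mu> \<in> K \<Longrightarrow> R \<mu> u"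
  obtains \<nu> where "\<nu> \<in> omega_limit P K" "invariant_measure P \<nu>" "\<And>\<mu>. \<mu> \<in> omega_limit P K \<Longrightarrow> R \<mu> \<nu>"
proof -
  have bounded: "W2_bounded {u}"
    using u by (simp add: W2.mbounded_insert)
  then interpret attracted_set P K "{u}"
    by (rule attracted_set)
  note sub = omega_limit_subset_omega_limit[OF bounded]
  have above: "R \<mu> x" if \<mu>: "\<mu> \<in> omega_limit P K" and x: "x \<in> omega_limit P {u}" for \<mu> x
  proof -
    obtain t b where t: "\<And>n. t n \<ge> real n" and b: "\<And>n. b n \<in> {u}"
      and lim: "limitin W2_topology (\<lambda>n. P (t n) (b n)) x sequentially"
      using x by (rule omega_limitE) blast
    have t0: "0 \<le> t n" for n
      using t[of n] by linarith
    \<comment> \<open>Invariance provides a preimage of \<open>\<mu>\<close> at time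
      \<open>t n\<close> inside \<open>K\<close>, where \<open>u\<close> is a bound; the flow
      preserves this comparison.\<close>
    have "R \<mu> (P (t n) u)" for n
    proof -
      obtain \<mu>' where "\<mu>' \<in> K" "\<mu> = P (t n) \<mu>'"
        using \<mu> omega_limit_subset_image[OF t0] by blast
      then show ?thesis
        using u K_P2 t0 by (auto intro: R_flow)
    qed
    moreover have "\<mu> \<in> P2"
      using \<mu> omega_limit_P2 by blast
    moreover have "b n = u" for n
      using b by simp
    ultimately show ?thesis
      using lim u(1) t0
      by (rule_tac R_limit[where \<mu> = "\<lambda>_. \<mu>" and \<nu> = "\<lambda>n. P (t n) u"])
        (simp_all add: W2.limitin_metric_dist_null flow_in_P2)
  qed
  obtain \<nu> where \<nu>: "\<nu> \<in> omega_limit P {u}"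
    using omega_limit_nonempty by auto
  \<comment> \<open>Two points of the limit set of \<open>{u}\<close> also lie in that of
    \<open>K\<close>, so by \<open>above\<close> each dominates the other.\<close>
  have unique: "x = \<nu>" if "x \<in> omega_limit P {u}" for x
  proof (rule R_antisym)
    have "x \<in> omega_limit P K" "\<nu> \<in> omega_limit P K"
      using that \<nu> sub by auto
    then show "x \<in> P2" "\<nu> \<in> P2" "R x \<nu>" "R \<nu> x"
      using omega_limit_P2 above that \<nu> by auto
  qed
  have "P t \<nu> = \<nu>" if "0 \<le> t" for t
  proof (rule unique)
    show "P t \<nu> \<in> omega_limit P {u}"
      using invariant_omega_limit \<nu> that by (auto simp: invariant_set_def)
  qed
  then have "invariant_measure P \<nu>"
    using \<nu> sub omega_limit_P2 by (auto simp: invariant_measure_def)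
  moreover have "\<nu> \<in> omega_limit P K"
    using \<nu> sub by blast
  ultimately show ?thesis
    using above[OF _ \<nu>] that by blast
qed

end

theorem proposition3p2:
  fixes P :: "real \<Rightarrow> real measure \<Rightarrow> real measure"
    and K :: "real measure set"
  assumes "semiflow P"
    and "order_preserving P"
    and "eventually_positively_invariant P K"
    and "order_bounded K"
    and "closedin W2_topology K"
    and "\<And>B. W2_bounded B \<Longrightarrow> attracts P K B"
  shows
    "(omega_limit P K = (\<Inter>t\<in>{0..}. P t ` K) \<and>
      global_attractor P (omega_limit P K) \<and>
      (connectedin W2_topology K \<longrightarrow> connectedin W2_topology (omega_limit P K))) \<and>
     (\<exists>\<nu>lo \<nu>hi.
      (\<nu>lo \<in> omega_limit P K \<and> invariant_measure P \<nu>lo \<and>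
       \<nu>hi \<in> omega_limit P K \<and> invariant_measure P \<nu>hi \<and>
       omega_limit P K \<subseteq> st_interval \<nu>lo \<nu>hi) \<and>
      ((\<forall>\<rho>\<in>P2. \<rho> \<le>\<^sub>s\<^sub>t \<nu>lo \<longrightarrow> ((\<lambda>t. W2 (P t \<rho>) \<nu>lo) \<longlongrightarrow> 0) at_top) \<and>
       (\<forall>\<rho>\<in>P2. \<nu>hi \<le>\<^sub>s\<^sub>t \<rho> \<longrightarrow> ((\<lambda>t. W2 (P t \<rho>) \<nu>hi) \<longlongrightarrow> 0) at_top)) \<and>
      ((\<forall>U. U \<subseteq> P2 \<and> attracts P {\<nu>lo} U \<longrightarrow>
          (\<forall>\<rho>\<in>(\<Union>\<mu>\<in>U. {\<rho>\<in>P2. \<rho> \<le>\<^sub>s\<^sub>t \<mu>}). attracts P {\<nu>lo} {\<rho>})) \<and>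
       (\<forall>V. V \<subseteq> P2 \<and> attracts P {\<nu>hi} V \<longrightarrow>
          (\<forall>\<rho>\<in>(\<Union>\<mu>\<in>V. {\<rho>\<in>P2. \<mu> \<le>\<^sub>s\<^sub>t \<rho>}). attracts P {\<nu>hi} {\<rho>}))) \<and>
      ((\<forall>\<rho>1\<in>P2. \<rho>1 <\<^sub>s\<^sub>t \<nu>hi \<and> ((\<lambda>t. W2 (P t \<rho>1) \<nu>hi) \<longlongrightarrow> 0) at_top \<longrightarrow>
          (\<forall>\<rho>\<in>P2. \<rho>1 \<le>\<^sub>s\<^sub>t \<rho> \<longrightarrow> ((\<lambda>t. W2 (P t \<rho>) \<nu>hi) \<longlongrightarrow> 0) at_top)) \<and>
       (\<forall>\<rho>2\<in>P2. \<nu>lo <\<^sub>s\<^sub>t \<rho>2 \<and> ((\<lambda>t. W2 (P t \<rho>2) \<nu>lo) \<longlongrightarrow> 0) at_top \<longrightarrow>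
          (\<forall>\<rho>\<in>P2. \<rho> \<le>\<^sub>s\<^sub>t \<rho>2 \<longrightarrow> ((\<lambda>t. W2 (P t \<rho>) \<nu>lo) \<longlongrightarrow> 0) at_top)))) \<and>
     (\<forall>\<nu>. invariant_measure P \<nu> \<and> (\<forall>\<mu>. invariant_measure P \<mu> \<longrightarrow> \<mu> = \<nu>) \<longrightarrow>
        global_attractor P {\<nu>} \<and> (\<forall>B. W2_bounded B \<longrightarrow> attracts P {\<nu>} B))"
proof -
  interpret global_attracting_set P K
    using assms by unfold_locales (auto intro: compactin_order_bounded)
  \<comment> \<open>Order preservation is given for \<open>t > 0\<close>; at \<open>t = 0\<close>
    the flow is the identity.\<close>
  have flow: "P t \<mu> \<le>\<^sub>s\<^sub>t P t \<nu>" if "\<mu> \<in> P2" "\<nu> \<in> P2" "\<mu> \<le>\<^sub>s\<^sub>t \<nu>" "0 \<le> t" for \<mu> \<nu> t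
    using assms(2) that flow_0 by (cases "t = 0") (auto simp: order_preserving_def)
  interpret up: ordered_attracting_set P K st_le
    by unfold_locales (fact st_le_limit st_le_antisym flow)+
  interpret down: ordered_attracting_set P K "\<lambda>\<mu> \<nu>. \<nu> \<le>\<^sub>s\<^sub>t \<mu>"
  proof unfold_locales
    show "\<nu>' \<le>\<^sub>s\<^sub>t \<mu>'" if "\<And>n. \<mu> n \<in> P2" "\<And>n. \<nu> n \<in> P2" "\<mu>' \<in> P2" "\<nu>' \<in> P2" "\<And>n. \<nu> n \<le>\<^sub>s\<^sub>t \<mu> n"
      "(\<lambda>n. W2 (\<mu> n) \<mu>') \<longlonglongrightarrow> 0" "(\<lambda>n. W2 (\<nu> n) \<nu>') \<longlonglongrightarrow> 0" for \<mu> \<nu> \<mu>' \<nu>'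
      using that(2,1,4,3,5,7,6) by (rule st_le_limit)
  qed (auto intro: st_le_antisym flow)
  obtain u where u: "u \<in> P2" "\<And>\<mu>. \<mu> \<in> K \<Longrightarrow> \<mu> \<le>\<^sub>s\<^sub>t u"
    using assms(4) unfolding order_bounded_def by blast
  obtain l where l: "l \<in> P2" "\<And>\<mu>. \<mu> \<in> K \<Longrightarrow> l \<le>\<^sub>s\<^sub>t \<mu>"
    using assms(4) unfolding order_bounded_def by blast
  obtain \<nu>hi where hi: "\<nu>hi \<in> omega_limit P K" "invariant_measure P \<nu>hi"
    "\<And>\<mu>. \<mu> \<in> omega_limit P K \<Longrightarrow> \<mu> \<le>\<^sub>s\<^sub>t \<nu>hi"
    using up.extremal_invariant_measure[OF u] by blast
  obtain \<nu>lo where lo: "\<nu>lo \<in> omega_limit P K" "invariant_measure P \<nu>lo"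
    "\<And>\<mu>. \<mu> \<in> omega_limit P K \<Longrightarrow> \<nu>lo \<le>\<^sub>s\<^sub>t \<mu>"
    using down.extremal_invariant_measure[OF l] by blast
  have P2: "\<nu>lo \<in> P2" "\<nu>hi \<in> P2"
    using lo hi by (auto simp: invariant_measure_def)
  have above: "((\<lambda>t. W2 (P t \<rho>) \<nu>hi) \<longlongrightarrow> 0) at_top"
    if "\<sigma> \<in> P2" "\<rho> \<in> P2" "\<sigma> \<le>\<^sub>s\<^sub>t \<rho>" "((\<lambda>t. W2 (P t \<sigma>) \<nu>hi) \<longlongrightarrow> 0) at_top" for \<sigma> \<rho>
    by (rule up.attracts_above[OF hi(1) _ that]) (rule hi(3))
  have below: "((\<lambda>t. W2 (P t \<rho>) \<nu>lo) \<longlongrightarrow> 0) at_top"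
    if "\<sigma> \<in> P2" "\<rho> \<in> P2" "\<rho> \<le>\<^sub>s\<^sub>t \<sigma>" "((\<lambda>t. W2 (P t \<sigma>) \<nu>lo) \<longlongrightarrow> 0) at_top" for \<sigma> \<rho>
    by (rule down.attracts_above[OF lo(1) _ that]) (rule lo(3))
  \<comment> \<open>With this, the claims about measures below \<open>\<nu>lo\<close> or above
    \<open>\<nu>hi\<close> become comparisons with a constant orbit.\<close>
  have fixed: "((\<lambda>t. W2 (P t \<nu>) \<nu>) \<longlongrightarrow> 0) at_top" if "invariant_measure P \<nu>" for \<nu>
    using that by (intro tendsto_eventually eventually_at_top_linorderI[of 0])
      (auto simp: invariant_measure_def)
  have attracted: "((\<lambda>t. W2 (P t \<mu>) \<nu>) \<longlongrightarrow> 0) at_top" if "attracts P {\<nu>} U" "\<mu> \<in> U" for \<nu> U \<mu>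
    using attracts_mono[OF that(1) order_refl, of "{\<mu>}"] that(2) by (simp add: attracts_singleton)
  have interval: "omega_limit P K \<subseteq> st_interval \<nu>lo \<nu>hi"
    using hi lo omega_limit_P2 by (auto simp: st_interval_def)
  have unique: "global_attractor P {\<nu>}"
    if "invariant_measure P \<nu>" "\<And>\<mu>. invariant_measure P \<mu> \<Longrightarrow> \<mu> = \<nu>" for \<nu>
  proof -
    \<comment> \<open>Both extremal measures are invariant, hence equal to \<open>\<nu>\<close>, and
      antisymmetry squeezes the attractor between them to a point.\<close>
    have "\<nu>lo = \<nu>" "\<nu>hi = \<nu>"
      using that lo hi by auto
    moreover from this have "\<mu> = \<nu>" if "\<mu> \<in> omega_limit P K" for \<mu>
      using that lo(3) hi(3) omega_limit_P2 P2 by (intro st_le_antisym) auto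
    ultimately have "omega_limit P K = {\<nu>}"
      using lo(1) by auto
    then show ?thesis
      using global_attractor_omega_limit by simp
  qed
  \<comment> \<open>In the premise, \<open>\<nu>lo\<close> and \<open>\<nu>hi\<close> are the
    measures obtained above, so \<open>intro\<close> introduces both quantifiers with these fixed
    witnesses.\<close>
  have witnesses: "\<exists>\<nu>lo \<nu>hi. Q \<nu>lo \<nu>hi" if "Q \<nu>lo \<nu>hi" for Q
    using that by blast
  show ?thesis
  proof (intro conjI witnesses ballI allI impI)
    show "((\<lambda>t. W2 (P t \<rho>) \<nu>lo) \<longlongrightarrow> 0) at_top" if "\<rho> \<in> P2" "\<rho> \<le>\<^sub>s\<^sub>t \<nu>lo" for \<rho>
      using P2(1) that fixed[OF lo(2)] by (rule below)
    show "((\<lambda>t. W2 (P t \<rho>) \<nu>hi) \<longlongrightarrow> 0) at_top" if "\<rho> \<in> P2" "\<nu>hi \<le>\<^sub>s\<^sub>t \<rho>" for \<rho>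
      using P2(2) that fixed[OF hi(2)] by (rule above)
    show "attracts P {\<nu>lo} {\<rho>}"
      if U: "U \<subseteq> P2 \<and> attracts P {\<nu>lo} U" and \<rho>: "\<rho> \<in> (\<Union>\<mu>\<in>U. {\<rho> \<in> P2. \<rho> \<le>\<^sub>s\<^sub>t \<mu>})" for U \<rho>
    proof -
      from \<rho> obtain \<mu> where \<mu>: "\<mu> \<in> U" and *: "\<rho> \<in> P2" "\<rho> \<le>\<^sub>s\<^sub>t \<mu>"
        by auto
      have "\<mu> \<in> P2"
        using U \<mu> by auto
      then show ?thesis
        unfolding attracts_singleton using * attracted[of \<nu>lo U, OF _ \<mu>] U by (intro below[of \<mu> \<rho>]) auto
    qed
    show "attracts P {\<nu>hi} {\<rho>}"
      if V: "V \<subseteq> P2 \<and> attracts P {\<nu>hi} V" and \<rho>: "\<rho> \<in> (\<Union>\<mu>\<in>V. {\<rho> \<in> P2. \<mu> \<le>\<^sub>s\<^sub>t \<rho>})" for V \<rho>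
    proof -
      from \<rho> obtain \<mu> where \<mu>: "\<mu> \<in> V" and *: "\<rho> \<in> P2" "\<mu> \<le>\<^sub>s\<^sub>t \<rho>"
        by auto
      have "\<mu> \<in> P2"
        using V \<mu> by auto
      then show ?thesis
        unfolding attracts_singleton using * attracted[of \<nu>hi V, OF _ \<mu>] V by (intro above[of \<mu> \<rho>]) auto
    qed
    show "((\<lambda>t. W2 (P t \<rho>) \<nu>hi) \<longlongrightarrow> 0) at_top"
      if "\<rho>1 \<in> P2" "\<rho>1 <\<^sub>s\<^sub>t \<nu>hi \<and> ((\<lambda>t. W2 (P t \<rho>1) \<nu>hi) \<longlongrightarrow> 0) at_top" "\<rho> \<in> P2" "\<rho>1 \<le>\<^sub>s\<^sub>t \<rho>"
      for \<rho>1 \<rho>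
      using that(1,3,4) conjunct2[OF that(2)] by (rule above)
    show "((\<lambda>t. W2 (P t \<rho>) \<nu>lo) \<longlongrightarrow> 0) at_top"
      if "\<rho>2 \<in> P2" "\<nu>lo <\<^sub>s\<^sub>t \<rho>2 \<and> ((\<lambda>t. W2 (P t \<rho>2) \<nu>lo) \<longlongrightarrow> 0) at_top" "\<rho> \<in> P2" "\<rho> \<le>\<^sub>s\<^sub>t \<rho>2"
      for \<rho>2 \<rho>
      using that(1,3,4) conjunct2[OF that(2)] by (rule below)
    show "global_attractor P {\<nu>}"
      if "invariant_measure P \<nu> \<and> (\<forall>\<mu>. invariant_measure P \<mu> \<longrightarrow> \<mu> = \<nu>)" for \<nu>
      using that by (intro unique) auto
    then show "attracts P {\<nu>} B"
      if "invariant_measure P \<nu> \<and> (\<forall>\<mu>. invariant_measure P \<mu> \<longrightarrow> \<mu> = \<nu>)" "W2_bounded B" for \<nu> B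
      using that unfolding global_attractor_def by blast
  qed (fact omega_limit_eq_INT global_attractor_omega_limit connectedin_omega_limit hi lo interval)+
qed

end
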